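(* Let $(X,\mathcal{X},\mu,T)$ be a non-periodic ergodic invertible measure preserving system, rigid for the sequence $(n_i)_{i\in\mathbb{N}}$. Then there exists a topological model $(\widehat{X},\widehat{T})$ for $(X,\mathcal{X},\mu,T)$ which is uniformly rigid for a subsequence of $(n_i)_{i\in\mathbb{N}}$. Moreover, $(\widehat{X},\widehat{T})$ can be taken topologically weakly mixing.
   Context: A measure preserving system is a 4-tuple $(X,\mathcal{X},\mu,T)$ where $(X,\mathcal{X},\mu)$ is a probability space and $T$ is a measurable measure preserving transformation of $X$; $T$ is assumed to be invertible, with both $T$ and $T^{-1}$ measure preserving. It is ergodic if every invariant set has measure $0$ or $1$. For an ergodic system, either $X$ consists of a finite set of points on which $\mu$ is equidistributed, in which case the system is called periodic, or $\mu$ is atomless, in which case the system is called non-periodic. The system $(X,\mathcal{X},\mu,T)$ is rigid for the increasing sequence $(n_i)_{i\in\mathbb{N}}$ in $\mathbb{N}$ (called a rigidity sequence) if $\|f-f\circ T^{n_i}\|_{2}\to 0$ as $i\to\infty$ for every $f\in L^2(\mu)$. A topological dynamical system is a pair $(Y,S)$ where $Y$ is a compact metric space (with metric $d$) and $S\colon Y\to Y$ is a homeomorphism. It is uniformly rigid for the increasing sequence $(m_i)_{i\in\mathbb{N}}$ in $\mathbb{N}$ if $\sup_{y\in Y} d(y,S^{m_i}y)\to 0$ as $i\to\infty$. It is transitive if there is a point $y\in Y$ whose orbit $\{S^ny:n\in\mathbb{Z}\}$ is dense in $Y$. It is (topologically) weakly mixing if the product system $(Y\times Y,S\times S)$ is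 transitive. A topological model for an ergodic system $(X,\mathcal{X},\mu,T)$ is a topological dynamical system $(\widehat{X},\widehat{T})$ together with a $\widehat{T}$-invariant Borel probability measure $\widehat{\mu}$ on $\widehat{X}$ such that $(X,\mathcal{X},\mu,T)$ and $(\widehat{X},\mathcal{B}(\widehat{X}),\widehat{\mu},\widehat{T})$ are measure theoretically isomorphic, where $\mathcal{B}(\widehat{X})$ is the Borel $\sigma$-algebra of $\widehat{X}$.
   Formalization: The probability space is assumed to be a standard (Lebesgue) space, and isomorphism is taken between completed measure spaces; for arbitrary probability spaces the claim fails, since a model on a compact metric space forces separable L². *)

theory Defs
  imports "HOL-Probability.Probability"
begin

section \<open>Measure preserving systems\<close>

definition invertible_mps :: "'a measure \<Rightarrow> ('a \<Rightarrow> 'a) \<Rightarrow> bool" where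
  "invertible_mps M T \<longleftrightarrow>
     prob_space M \<and>
     bij_betw T (space M) (space M) \<and>
     T \<in> measurable M M \<and> distr M M T = M \<and>
     the_inv_into (space M) T \<in> measurable M M \<and>
     distr M M (the_inv_into (space M) T) = M"

definition ergodic :: "'a measure \<Rightarrow> ('a \<Rightarrow> 'a) \<Rightarrow> bool" where
  "ergodic M T \<longleftrightarrow>
     (\<forall>A\<in>sets M. T -` A \<inter> space M = A \<longrightarrow> measure M A = 0 \<or> measure M A = 1)"

definition atom :: "'a measure \<Rightarrow> 'a set \<Rightarrow> bool" where
  "atom M A \<longleftrightarrow>
     A \<in> sets M \<and> emeasure M A > 0 \<and>
     (\<forall>B\<in>sets M. B \<subseteq> A \<longrightarrow> emeasure M B = 0 \<or> emeasure M B = emeasure M A)"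

definition non_periodic :: "'a measure \<Rightarrow> bool" where
  "non_periodic M \<longleftrightarrow> (\<nexists>A. atom M A)"

definition square_integrable :: "'a measure \<Rightarrow> ('a \<Rightarrow> complex) \<Rightarrow> bool" where
  "square_integrable M f \<longleftrightarrow>
     f \<in> borel_measurable M \<and> integrable M (\<lambda>x. (cmod (f x))\<^sup>2)"

definition norm_L2 :: "'a measure \<Rightarrow> ('a \<Rightarrow> complex) \<Rightarrow> real" where
  "norm_L2 M f = sqrt (\<integral>x. (cmod (f x))\<^sup>2 \<partial>M)"

definition rigid :: "'a measure \<Rightarrow> ('a \<Rightarrow> 'a) \<Rightarrow> (nat \<Rightarrow> nat) \<Rightarrow> bool" where
  "rigid M T n \<longleftrightarrow>
     strict_mono n \<and>
     (\<forall>f. square_integrable M f \<longrightarrow>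
        (\<lambda>i. norm_L2 M (\<lambda>x. f x - f ((T ^^ n i) x))) \<longlonglongrightarrow> 0)"


section \<open>Isomorphism modulo null sets\<close>

definition iso_mod0 ::
  "'a measure \<Rightarrow> 'b measure \<Rightarrow> 'a set \<Rightarrow> 'b set \<Rightarrow> ('a \<Rightarrow> 'b) \<Rightarrow> bool" where
  "iso_mod0 M N X Y \<phi> \<longleftrightarrow>
     X \<in> sets M \<and> space M - X \<in> null_sets M \<and>
     Y \<in> sets N \<and> space N - Y \<in> null_sets N \<and>
     bij_betw \<phi> X Y \<and>
     \<phi> \<in> measurable (restrict_space M X) (restrict_space N Y) \<and>
     the_inv_into X \<phi> \<in> measurable (restrict_space N Y) (restrict_space M X) \<and>
     distr (restrict_space M X) (restrict_space N Y) \<phi> = restrict_space N Y"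

text \<open>
  Isomorphisms are taken between the completed spaces, as is usual for Lebesgue spaces: with the
  raw \<open>\<sigma>\<close>-algebras, a space carrying a complete measure (such as Lebesgue measure on the
  unit interval) would not be isomorphic to any space carrying its Borel \<open>\<sigma>\<close>-algebra.
  Between standard Borel spaces the completions make no difference, up to shrinking the sets of
  full measure.
\<close>

definition isomorphic_mps ::
  "'a measure \<Rightarrow> ('a \<Rightarrow> 'a) \<Rightarrow> 'b measure \<Rightarrow> ('b \<Rightarrow> 'b) \<Rightarrow> bool" where
  "isomorphic_mps M T N S \<longleftrightarrow>
     (\<exists>X Y \<phi>. iso_mod0 (completion M) (completion N) X Y \<phi> \<and>
        T ` X = X \<and> S ` Y = Y \<and> (\<forall>x\<in>X. \<phi> (T x) = S (\<phi> x)))"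

text \<open>
  Standard (Lebesgue--Rokhlin) probability spaces. Since every standard Borel space is Borel
  isomorphic to a Borel subset of the real line, it suffices to compare with Borel
  probability measures on the reals; these may have atoms.
\<close>

definition standard_space :: "'a measure \<Rightarrow> bool" where
  "standard_space M \<longleftrightarrow>
     (\<exists>(\<nu> :: real measure) X Y \<phi>. prob_space \<nu> \<and> sets \<nu> = sets borel \<and>
        iso_mod0 (completion M) (completion \<nu>) X Y \<phi>)"


section \<open>Topological dynamical systems\<close>

definition tds :: "'b::metric_space set \<Rightarrow> ('b \<Rightarrow> 'b) \<Rightarrow> bool" where
  "tds Y S \<longleftrightarrow> compact Y \<and> (\<exists>S'. homeomorphism Y Y S S')"

definition int_iterate :: "'b set \<Rightarrow> ('b \<Rightarrow> 'b) \<Rightarrow> int \<Rightarrow> 'b \<Rightarrow> 'b" where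
  "int_iterate Y S k =
     (if k \<ge> 0 then S ^^ nat k else the_inv_into Y S ^^ nat (- k))"

definition transitive :: "'b::metric_space set \<Rightarrow> ('b \<Rightarrow> 'b) \<Rightarrow> bool" where
  "transitive Y S \<longleftrightarrow>
     (\<exists>y\<in>Y. Y \<subseteq> closure (range (\<lambda>k::int. int_iterate Y S k y)))"

definition weakly_mixing :: "'b::metric_space set \<Rightarrow> ('b \<Rightarrow> 'b) \<Rightarrow> bool" where
  "weakly_mixing Y S \<longleftrightarrow> transitive (Y \<times> Y) (map_prod S S)"

definition uniformly_rigid ::
  "'b::metric_space set \<Rightarrow> ('b \<Rightarrow> 'b) \<Rightarrow> (nat \<Rightarrow> nat) \<Rightarrow> bool" where
  "uniformly_rigid Y S m \<longleftrightarrow>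
     strict_mono m \<and> (\<lambda>i. SUP y\<in>Y. dist y ((S ^^ m i) y)) \<longlonglongrightarrow> 0"

definition topological_model ::
  "'a measure \<Rightarrow> ('a \<Rightarrow> 'a) \<Rightarrow> 'b::metric_space set \<Rightarrow> ('b \<Rightarrow> 'b) \<Rightarrow> 'b measure \<Rightarrow> bool" where
  "topological_model M T Y S \<mu> \<longleftrightarrow>
     tds Y S \<and>
     prob_space \<mu> \<and> space \<mu> = Y \<and> sets \<mu> = sets (restrict_space borel Y) \<and>
     distr \<mu> \<mu> S = \<mu> \<and>
     isomorphic_mps M T \<mu> S"

text \<open>
  Existentially quantified compact metric spaces can be taken to be compact subsets of \<open>nat \<Rightarrow> real\<close> with its
  product metric. This loses nothing: every compact metric space embeds
  homeomorphically into the Hilbert cube, and all the notions above, including uniform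
  rigidity, depend only on the topology of the compact space.
\<close>

end

theory Submission
  imports Defs
begin

text \<open>
  The model lives in a compact space of arrays that depends on the system only through a
  rigidity sequence \<open>m\<close>. An array is a real function of a row \<open>c \<in> \<nat>\<close> and a time
  \<open>t \<in> \<int>\<close>, the dynamics is the translation of time, and an array is admitted if its entries are
  bounded by 2 and, in row \<open>c\<close>, a translation by \<open>m i\<close> with \<open>i \<ge> c\<close> changes every entry by at most
  \<open>4 / (i + 1)\<close>. These conditions are closed and invariant, and they say directly that translation
  by \<open>m i\<close> tends to the identity uniformly. So \<open>near_periodic m\<close> is a uniformly rigid compact
  system for every increasing \<open>m\<close>. It remains to see that it is weakly mixing, and that it carries a measure
  isomorphic to the given one.

  Weak mixing holds as soon as \<open>m\<close> grows fast. The space is convex, so two arrays \<open>u\<close> and \<open>v\<close> can be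
  glued: take a weight \<open>L t\<close> that is nearly 1 around time 0 and nearly 0 around some time \<open>N\<close>, and
  mix \<open>u\<close> with the translate of \<open>v\<close> by \<open>N\<close> in the proportion \<open>L t : 1 - L t\<close>. The result is admissible,
  after shrinking it a little, if \<open>L\<close> itself is almost unchanged by each translation \<open>m i\<close>. Such
  a weight is \<open>(1 + cos (2 * pi * \<alpha> * t)) / 2\<close>, where \<open>\<alpha> > 0\<close> is tiny and every \<open>\<alpha> * m i\<close> is very close
  to an integer; rapid growth of \<open>m\<close> provides \<open>\<alpha>\<close> (\<open>small_common_near_period\<close>). As \<open>N\<close> does not
  depend on \<open>u\<close> and \<open>v\<close>, the product system is transitive by Baire's theorem.

  For the measure, let \<open>g\<close> be a bounded observable that is injective up to a null set. Replacing
  \<open>f\<close> by its average over the \<open>i + 1\<close> translates by the multiples \<open>0, m i, \<dots>, i * m i\<close> makes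
  \<open>f\<close> vary by at most \<open>4 / (i + 1)\<close> under \<open>T ^^ m i\<close> at every point, by telescoping; it does not spoil
  a bound of this kind that holds for another time, and by rigidity it moves \<open>f\<close> very little in
  \<open>L\<^sup>1\<close> if \<open>m i\<close> is chosen late enough in the rigidity sequence. Averaging successively for
  \<open>i = c, c + 1, \<dots>\<close> gives almost everywhere a limit \<open>f c\<close> that obeys the bounds demanded of row \<open>c\<close>,
  and \<open>f c\<close> tends to \<open>g\<close> almost everywhere as \<open>c\<close> grows (\<open>AE_smoothing_converges\<close>). Reading the
  functions \<open>f c\<close> along the orbit of \<open>x\<close> therefore defines an equivariant map \<open>\<Phi>\<close> into
  \<open>near_periodic m\<close>, and \<open>g x\<close> is recovered from \<open>\<Phi> x\<close> as the limit of the entries at time 0 along the rows. Hence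
  \<open>\<Phi>\<close> loses nothing, and it is an isomorphism onto its image measure (\<open>isomorphic_mps_factor\<close>).
  The image measure may be concentrated on a small part of \<open>near_periodic m\<close>: weak mixing comes from
  the ambient space, not from the system.
\<close>

section \<open>The space of nearly periodic arrays\<close>

text \<open>
  The metric is a weighted sum over all coordinates, of which only finitely many matter at a given
  scale; estimates on finitely many entries are all that is ever needed below.
\<close>

lemma dist_fun_less_from_coordinates:
  fixes e :: real
  assumes "e > 0"
  obtains K :: nat and d :: real where "d > 0"
    "\<And>x y :: nat \<Rightarrow> real. (\<And>k. k \<le> K \<Longrightarrow> \<bar>x k - y k\<bar> \<le> d) \<Longrightarrow> dist x y < e"
proof -
  obtain N :: nat where N: "(1/2)^N < e/2"
    using real_arch_pow_inv[of "e/2" "1/2"] assms by auto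
  define K where "K = Max ((from_nat :: nat \<Rightarrow> nat) ` {..N})"
  show thesis
  proof
    show "e/8 > 0" using assms by simp
    fix x y :: "nat \<Rightarrow> real"
    assume close: "\<And>k. k \<le> K \<Longrightarrow> \<bar>x k - y k\<bar> \<le> e/8"
    let ?A = "{dist (x (from_nat n)) (y (from_nat n)) |n. n \<le> N}"
    have eq: "?A = (\<lambda>n. dist (x (from_nat n)) (y (from_nat n))) ` {..N}"
      by auto
    have "Max ?A \<le> e/8"
    proof (rule Max.boundedI)
      show "finite ?A" "?A \<noteq> {}" unfolding eq by auto
      fix a assume "a \<in> ?A"
      then obtain n where n: "n \<le> N" "a = dist (x (from_nat n)) (y (from_nat n))" by auto
      have "(from_nat n :: nat) \<le> K" unfolding K_def using n(1) by (intro Max_ge) auto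
      with n(2) close show "a \<le> e/8" by (simp add: dist_real_def)
    qed
    with dist_fun_le_dist_first_terms[of x y N] N assms show "dist x y < e"
      by simp
  qed
qed

text \<open>
  A sequence is read as an array: the index \<open>k\<close> stands for the pair of its row and its
  time, an integer.
\<close>

definition row_of :: "nat \<Rightarrow> nat" where "row_of k = fst (prod_decode k)"
definition time_of :: "nat \<Rightarrow> int" where "time_of k = int_decode (snd (prod_decode k))"
definition cell_at :: "nat \<Rightarrow> int \<Rightarrow> nat" where "cell_at c t = prod_encode (c, int_encode t)"

lemma row_cell [simp]: "row_of (cell_at c t) = c"
  and time_cell [simp]: "time_of (cell_at c t) = t"
  and cell_row_time [simp]: "cell_at (row_of k) (time_of k) = k"
  by (simp_all add: row_of_def time_of_def cell_at_def)

definition shift_array :: "int \<Rightarrow> (nat \<Rightarrow> real) \<Rightarrow> nat \<Rightarrow> real" where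
  "shift_array p y = (\<lambda>k. y (cell_at (row_of k) (time_of k + p)))"

lemma shift_shift [simp]: "shift_array p (shift_array q y) = shift_array (p + q) y"
  by (simp add: shift_array_def add.assoc)

lemma shift_0 [simp]: "shift_array 0 y = y"
  by (simp add: shift_array_def)

lemma funpow_shift: "(shift_array 1 ^^ j) y = shift_array (int j) y"
  by (induction j) (simp_all add: add.commute)

lemma continuous_on_shift: "continuous_on A (shift_array p)"
  unfolding shift_array_def
  by (intro continuous_on_coordinatewise_then_product)
     (rule continuous_on_subset[OF continuous_on_product_coordinates], simp)

text \<open>
  In row \<open>c\<close> only the translations \<open>m i\<close> with \<open>i \<ge> c\<close> are controlled. The lower rows may start with
  larger distortions, which leaves the later rows free to approximate a given observable better and
  better.
\<close>

definition near_periodic :: "(nat \<Rightarrow> nat) \<Rightarrow> (nat \<Rightarrow> real) set" where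
  "near_periodic m = {y. \<forall>k. \<bar>y k\<bar> \<le> 2 \<and>
     (\<forall>i\<ge>row_of k. \<bar>shift_array (int (m i)) y k - y k\<bar> \<le> 4 / real (i + 1))}"

lemma near_periodic_shift:
  assumes "y \<in> near_periodic m"
  shows "shift_array p y \<in> near_periodic m"
proof -
  have "\<bar>shift_array p y k\<bar> \<le> 2 \<and>
     (\<forall>i\<ge>row_of k. \<bar>shift_array (int (m i)) (shift_array p y) k - shift_array p y k\<bar> \<le> 4 / real (i + 1))" for k
  proof -
    let ?k = "cell_at (row_of k) (time_of k + p)"
    have "\<bar>y ?k\<bar> \<le> 2 \<and> (\<forall>i\<ge>row_of ?k. \<bar>shift_array (int (m i)) y ?k - y ?k\<bar> \<le> 4 / real (i + 1))"
      using assms unfolding near_periodic_def by blast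
    thus ?thesis by (simp add: shift_array_def algebra_simps)
  qed
  thus ?thesis unfolding near_periodic_def by blast
qed

lemma compact_near_periodic: "compact (near_periodic m)"
proof -
  have "compactin (product_topology (\<lambda>_. euclidean) UNIV) (PiE (UNIV :: nat set) (\<lambda>_. {-2..2::real}))"
    by (subst compactin_PiE) auto
  hence box: "compact (PiE (UNIV :: nat set) (\<lambda>_. {-2..2::real}))"
    by (simp add: euclidean_product_topology)
  have cont: "continuous_on UNIV (\<lambda>y :: nat \<Rightarrow> real. shift_array p y k)" for p k
    unfolding shift_array_def by (rule continuous_on_product_coordinates)
  have "near_periodic m = (\<Inter>k. {y. \<bar>y k\<bar> \<le> 2}) \<inter>
      (\<Inter>k. \<Inter>i\<in>{row_of k..}. {y. \<bar>shift_array (int (m i)) y k - y k\<bar> \<le> 4 / real (i + 1)})"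
    unfolding near_periodic_def by fastforce
  also have "closed \<dots>"
    by (intro closed_Int closed_INT ballI closed_Collect_le continuous_intros cont
        continuous_on_product_coordinates)
  finally have "closed (near_periodic m)" .
  moreover have "near_periodic m \<subseteq> PiE UNIV (\<lambda>_. {-2..2})"
    by (auto simp: near_periodic_def PiE_def abs_le_iff) (smt (verit))+
  ultimately show ?thesis
    using box by (metis compact_Int_closed inf.absorb_iff2)
qed

lemma tds_near_periodic: "tds (near_periodic m) (shift_array 1)"
proof -
  have "homeomorphism (near_periodic m) (near_periodic m) (shift_array 1) (shift_array (-1))"
    by (rule homeomorphismI)
       (auto intro: continuous_on_shift simp: near_periodic_shift)
  thus ?thesis
    unfolding tds_def using compact_near_periodic by blast
qed

text \<open>
  A given scale only sees finitely many rows, and as soon as \<open>i\<close> exceeds all of them, translation by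
  \<open>m i\<close> moves each of the relevant entries by at most \<open>4 / (i + 1)\<close>.
\<close>

lemma uniformly_rigid_near_periodic:
  assumes "strict_mono m"
  shows "uniformly_rigid (near_periodic m) (shift_array 1) m"
  unfolding uniformly_rigid_def funpow_shift
proof (intro conjI assms)
  let ?Y = "near_periodic m"
  have zero: "(\<lambda>_. 0) \<in> ?Y"
    by (simp add: near_periodic_def shift_array_def)
  show "(\<lambda>i. SUP y\<in>?Y. dist y (shift_array (int (m i)) y)) \<longlonglongrightarrow> 0"
  proof (rule LIMSEQ_I)
    fix e :: real assume "e > 0"
    then obtain K d where d: "d > 0"
      and close: "\<And>x y :: nat \<Rightarrow> real. (\<And>k. k \<le> K \<Longrightarrow> \<bar>x k - y k\<bar> \<le> d) \<Longrightarrow> dist x y < e/2"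
      using dist_fun_less_from_coordinates[of "e/2"] by (metis half_gt_zero)
    obtain I :: nat where I: "4 / d < real I" using reals_Archimedean2 by blast
    define J where "J = max I (Max (row_of ` {..K}))"
    show "\<exists>N. \<forall>i\<ge>N. norm ((SUP y\<in>?Y. dist y (shift_array (int (m i)) y)) - 0) < e"
    proof (intro exI allI impI)
      fix i assume i: "J \<le> i"
      have small: "4 / real (i + 1) \<le> d"
      proof -
        have "4 / d < real (i + 1)" using I i unfolding J_def by linarith
        thus ?thesis using d by (simp add: field_simps)
      qed
      have le: "dist y (shift_array (int (m i)) y) \<le> e/2" if y: "y \<in> ?Y" for y
      proof (rule less_imp_le, rule close)
        fix k assume "k \<le> K"
        hence "row_of k \<le> i" using i unfolding J_def
          by (meson Max_ge atMost_iff finite_atMost finite_imageI image_eqI le_trans max.bounded_iff)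
        with y have "\<bar>shift_array (int (m i)) y k - y k\<bar> \<le> 4 / real (i + 1)"
          unfolding near_periodic_def by blast
        thus "\<bar>y k - shift_array (int (m i)) y k\<bar> \<le> d" using small by linarith
      qed
      have "(SUP y\<in>?Y. dist y (shift_array (int (m i)) y)) \<le> e/2"
        using zero le by (intro cSUP_least) auto
      moreover have "0 \<le> (SUP y\<in>?Y. dist y (shift_array (int (m i)) y))"
        using zero le by (intro cSUP_upper2[where x = "\<lambda>_. 0"] bdd_aboveI2[where M = "e/2"]) auto
      ultimately show "norm ((SUP y\<in>?Y. dist y (shift_array (int (m i)) y)) - 0) < e"
        using \<open>e > 0\<close> by simp
    qed
  qed
qed

section \<open>Gluing two arrays\<close>

text \<open>
  The frequency constructed below satisfies \<open>\<alpha> * m i \<in> \<int>\<close> up to an error of order \<open>m i / m (i + 1)\<close>, and this has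
  to lie below an arbitrarily small multiple of \<open>1 / (i + 1)\<close> for all late \<open>i\<close>. Hence the quadratic
  factor.
\<close>

definition fast_growing :: "(nat \<Rightarrow> nat) \<Rightarrow> bool" where
  "fast_growing m \<longleftrightarrow> 0 < m 0 \<and> (\<forall>i. (i + 2)\<^sup>2 * m i \<le> m (Suc i))"

lemma fast_growing_pos: "fast_growing m \<Longrightarrow> 0 < m i"
proof (induction i)
  case (Suc i)
  hence "0 < (i + 2)\<^sup>2 * m i" by simp
  also have "\<dots> \<le> m (Suc i)" using Suc by (simp add: fast_growing_def)
  finally show ?case .
qed (simp add: fast_growing_def)

lemma fast_growing_strict_mono:
  assumes "fast_growing m"
  shows "strict_mono m"
proof (rule strict_mono_Suc_iff[THEN iffD2], rule allI)
  fix i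
  have "m i < 4 * m i" using fast_growing_pos[OF assms] by simp
  also have "\<dots> \<le> (i + 2)\<^sup>2 * m i" by (simp add: power2_eq_square)
  also have "\<dots> \<le> m (Suc i)" using assms by (simp add: fast_growing_def)
  finally show "m i < m (Suc i)" .
qed

lemma abs_cos_diff_le: "\<bar>cos x - cos y\<bar> \<le> \<bar>x - y\<bar>" for x y :: real
proof -
  have "\<bar>cos x - cos y\<bar> = 2 * (\<bar>sin ((x + y) / 2)\<bar> * \<bar>sin ((y - x) / 2)\<bar>)"
    by (simp add: cos_diff_cos abs_mult)
  also have "\<dots> \<le> 2 * (1 * \<bar>(y - x) / 2\<bar>)"
    by (intro mult_left_mono mult_mono abs_sin_le_one abs_sin_x_le_abs_x) auto
  finally show ?thesis by simp
qed

text \<open>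
  The frequency is the limit of an increasing sequence \<open>a j\<close>: start with \<open>1 / m s\<close> and
  round up to the next multiple of \<open>1 / m (s + j)\<close> for \<open>j = 1, 2, \<dots>\<close>. After step \<open>j\<close> the product with
  \<open>m (s + j)\<close> is an integer, and all later steps together add at most \<open>2 / m (s + j + 1)\<close>, which is at
  most \<open>1 / m (s + j)\<close> times \<open>2 / (s + j + 2)\<^sup>2\<close>. For \<open>i < s\<close> the product with \<open>m i\<close> is itself close to 0.
\<close>

lemma small_common_near_period:
  assumes m: "fast_growing m"
  obtains \<alpha> :: real where "0 < \<alpha>" "\<alpha> \<le> 2 / real (s + 1)"
    "\<And>i. \<exists>z::int. \<bar>\<alpha> * real (m i) - z\<bar> \<le> 2 / (real (s + 1) * real (i + 1))"
proof -
  define M where "M j = real (m (s + j))" for j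
  have Mpos: "0 < M j" for j unfolding M_def using fast_growing_pos[OF m] by simp
  have Mgrow: "real (s + j + 2)^2 * M j \<le> M (Suc j)" for j
  proof -
    have "(s + j + 2)\<^sup>2 * m (s + j) \<le> m (Suc (s + j))" using m unfolding fast_growing_def by blast
    from of_nat_mono[OF this, where 'a = real] show ?thesis unfolding M_def by simp
  qed
  have M4: "4 * M j \<le> M (Suc j)" for j
  proof -
    have "2^2 \<le> real (s + j + 2)^2" by (rule power_mono) auto
    hence "4 * M j \<le> real (s + j + 2)^2 * M j" using Mpos[of j] by (intro mult_right_mono) auto
    thus ?thesis using Mgrow[of j] by linarith
  qed
  define a where "a = rec_nat (1 / M 0) (\<lambda>j x. real_of_int \<lceil>x * M (Suc j)\<rceil> / M (Suc j))"
  have a0: "a 0 = 1 / M 0" and aSuc: "a (Suc j) = real_of_int \<lceil>a j * M (Suc j)\<rceil> / M (Suc j)" for j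
    by (simp_all add: a_def)
  have up: "a j \<le> a (Suc j)" for j
    unfolding aSuc using Mpos[of "Suc j"] by (simp add: le_divide_eq)
  have step: "a (Suc j) \<le> a j + 1 / M (Suc j)" for j
  proof -
    have "real_of_int \<lceil>a j * M (Suc j)\<rceil> \<le> a j * M (Suc j) + 1" by linarith
    thus ?thesis unfolding aSuc using Mpos[of "Suc j"] by (simp add: field_simps)
  qed
  \<comment> \<open>The intervals from \<open>a j\<close> to \<open>b j\<close> are nested, and the frequency is their common point.\<close>
  define b where "b j = a j + 2 / M (Suc j)" for j
  have down: "b (Suc j) \<le> b j" for j
  proof -
    have "2 / M (Suc (Suc j)) \<le> 2 / (4 * M (Suc j))"
      using M4[of "Suc j"] Mpos[of "Suc j"] by (intro divide_left_mono) (auto simp: Mpos)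
    moreover have "2 / (4 * M (Suc j)) \<le> 1 / M (Suc j)"
      using Mpos[of "Suc j"] by (simp add: field_simps)
    ultimately show ?thesis using step[of j] unfolding b_def by simp
  qed
  have "incseq a" using up by (rule incseq_SucI)
  have "decseq b" using down by (rule decseq_SucI)
  have ab: "a j \<le> b k" for j k
  proof -
    have "a j \<le> a (max j k)" using \<open>incseq a\<close> by (simp add: incseq_def)
    also have "\<dots> \<le> b (max j k)" unfolding b_def using Mpos by (simp add: less_imp_le)
    also have "\<dots> \<le> b k" using \<open>decseq b\<close> by (simp add: decseq_def)
    finally show ?thesis .
  qed
  define \<alpha> where "\<alpha> = (SUP j. a j)"
  have bdd: "bdd_above (range a)" using ab by (intro bdd_aboveI2) blast
  have lo: "a j \<le> \<alpha>" for j unfolding \<alpha>_def using bdd by (intro cSUP_upper) auto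
  have hi: "\<alpha> \<le> b j" for j unfolding \<alpha>_def using ab by (intro cSUP_least) auto
  have int_a: "\<exists>z::int. a j * M j = z" for j
  proof (cases j)
    case 0 thus ?thesis using Mpos[of 0] by (intro exI[of _ 1]) (simp add: a0)
  next
    case (Suc j') thus ?thesis using Mpos[of j] by (intro exI) (simp add: aSuc)
  qed
  have \<alpha>pos: "0 < \<alpha>" using lo[of 0] Mpos[of 0] unfolding a0 by (meson divide_pos_pos less_le_trans zero_less_one)
  have \<alpha>le: "\<alpha> \<le> 2 / M 0"
  proof -
    have "2 / M (Suc 0) \<le> 2 / (4 * M 0)"
      using M4[of 0] Mpos[of 0] Mpos[of "Suc 0"] by (intro divide_left_mono) auto
    moreover have "2 / (4 * M 0) \<le> 1 / M 0" using Mpos[of 0] by (simp add: field_simps)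
    moreover have "1 / M 0 + 1 / M 0 = 2 / M 0" by simp
    ultimately show ?thesis using hi[of 0] unfolding b_def a0 by linarith
  qed
  have Mge: "real (m i) * real (s + 1)^2 \<le> M 0" if i: "i < s" for i
  proof -
    obtain r where r: "s = Suc r" using i by (cases s) auto
    have "(r + 2)\<^sup>2 * m r \<le> m s" using m unfolding fast_growing_def r by blast
    moreover have "m i \<le> m r" using i r fast_growing_strict_mono[OF m] by (simp add: strict_mono_less_eq)
    hence "(r + 2)\<^sup>2 * m i \<le> (r + 2)\<^sup>2 * m r" by simp
    ultimately have "(r + 2)\<^sup>2 * m i \<le> m s" by linarith
    from of_nat_mono[OF this, where 'a = real] show ?thesis
      unfolding M_def by (simp add: r mult.commute add.commute)
  qed
  have M0: "real (s + 1) \<le> M 0"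
  proof -
    have "s < m s"
    proof (induction s)
      case 0 show ?case using fast_growing_pos[OF m] .
    next
      case (Suc s)
      moreover have "m s < m (Suc s)"
        using fast_growing_strict_mono[OF m] by (simp add: strict_mono_Suc_iff)
      ultimately show ?case by linarith
    qed
    thus ?thesis unfolding M_def by simp
  qed
  show thesis
  proof (rule that[OF \<alpha>pos])
    show "\<alpha> \<le> 2 / real (s + 1)"
    proof -
      have "2 / M 0 \<le> 2 / real (s + 1)" using M0 by (intro divide_left_mono) (auto simp: Mpos)
      thus ?thesis using \<alpha>le by linarith
    qed
    fix i
    show "\<exists>z::int. \<bar>\<alpha> * real (m i) - z\<bar> \<le> 2 / (real (s + 1) * real (i + 1))"
    proof (cases "i < s")
      case True
      have p: "0 < real (m i)" using fast_growing_pos[OF m] by simp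
      have "\<alpha> * real (m i) \<le> 2 / M 0 * real (m i)" using \<alpha>le p by (intro mult_right_mono) auto
      also have "\<dots> \<le> 2 / (real (m i) * real (s + 1)^2) * real (m i)"
        using Mge[OF True] p Mpos[of 0] by (intro mult_right_mono divide_left_mono) auto
      also have "\<dots> = 2 / (real (s + 1) * real (s + 1))"
        using p by (simp add: power2_eq_square)
      also have "\<dots> \<le> 2 / (real (s + 1) * real (i + 1))"
        using True by (intro divide_left_mono mult_left_mono) auto
      finally show ?thesis using \<alpha>pos p by (intro exI[of _ 0]) simp
    next
      case False
      then obtain j where i: "i = s + j" by (metis le_add_diff_inverse not_less)
      obtain z :: int where z: "a j * M j = z" using int_a by blast
      have "0 \<le> (\<alpha> - a j) * M j" using lo[of j] Mpos[of j] by simp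
      moreover have "(\<alpha> - a j) * M j \<le> 2 / M (Suc j) * M j"
        using hi[of j] Mpos[of j] unfolding b_def by (intro mult_right_mono) auto
      moreover have "2 / M (Suc j) * M j \<le> 2 / (real (s + j + 2)^2 * M j) * M j"
        using Mgrow[of j] Mpos[of j] Mpos[of "Suc j"] by (intro mult_right_mono divide_left_mono) auto
      moreover have "2 / (real (s + j + 2)^2 * M j) * M j = 2 / (real (s + j + 2) * real (s + j + 2))"
        using Mpos[of j] by (simp add: power2_eq_square)
      moreover have "2 / (real (s + j + 2) * real (s + j + 2)) \<le> 2 / (real (s + 1) * real (i + 1))"
        unfolding i by (intro divide_left_mono mult_mono) auto
      ultimately show ?thesis
        using z unfolding i M_def[symmetric] by (intro exI[of _ z]) (simp add: algebra_simps)
    qed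
  qed
qed

text \<open>
  The weight \<open>L\<close> has values near 1 on the window of radius \<open>R\<close> around 0 and near 0 on the one around
  \<open>N\<close>, half a period of the cosine later. Translation by \<open>m i\<close> changes \<open>L\<close> by at most
  \<open>4 * h / (i + 1)\<close>, hence the mixture by at most \<open>(1 + 4 * h) * (4 / (i + 1))\<close>; the contraction by the
  factor \<open>1 - 4 * h\<close> compensates for this. It also costs a distance of at most \<open>8 * h\<close>, which explains
  the choice of \<open>h\<close> in terms of \<open>e\<close> and \<open>R\<close>.
\<close>

lemma near_periodic_glue:
  fixes e :: real
  assumes m: "fast_growing m" and "e > 0"
  shows "\<exists>N::nat. \<forall>u\<in>near_periodic m. \<forall>v\<in>near_periodic m. \<exists>y\<in>near_periodic m.
           \<forall>k\<le>K. \<bar>y k - u k\<bar> < e \<and> \<bar>shift_array (int N) y k - v k\<bar> < e"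
proof -
  define R where "R = real (Max ((\<lambda>k. nat \<bar>time_of k\<bar>) ` {..K}))"
  have R: "\<bar>real_of_int (time_of k)\<bar> \<le> R" if "k \<le> K" for k
  proof -
    have "nat \<bar>time_of k\<bar> \<le> Max ((\<lambda>k. nat \<bar>time_of k\<bar>) ` {..K})"
      using that by (intro Max_ge) auto
    thus ?thesis unfolding R_def by linarith
  qed
  have R0: "0 \<le> R" unfolding R_def by simp
  define h where "h = min (1/4) (e / (32 * (R + 2)))"
  have h: "0 < h" "h \<le> 1/4"
    using assms(2) R0 min.cobounded1[of "1/4"] unfolding h_def by (simp, blast)
  have he: "8 * h + 16 * h * (R + 1) < e"
  proof -
    have "h * (32 * (R + 2)) \<le> e"
      using R0 h_def by (subst pos_le_divide_eq[symmetric]) auto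
    moreover have "8 * h + 16 * h * (R + 1) < h * (32 * (R + 2))"
      using h(1) R0 by (simp add: algebra_simps add_pos_nonneg)
    ultimately show ?thesis by linarith
  qed
  obtain s :: nat where s: "2 / h < real s" using reals_Archimedean2 by blast
  have sh: "2 / real (s + 1) \<le> h"
  proof -
    have "2 < real s * h" using s h by (simp add: divide_less_eq)
    also have "\<dots> \<le> real (s + 1) * h" using h by (intro mult_right_mono) auto
    finally show ?thesis by (simp add: divide_le_eq mult.commute)
  qed
  obtain \<alpha> :: real where \<alpha>: "0 < \<alpha>" "\<alpha> \<le> 2 / real (s + 1)"
    and near: "\<And>i. \<exists>z::int. \<bar>\<alpha> * real (m i) - z\<bar> \<le> 2 / (real (s + 1) * real (i + 1))"
    using small_common_near_period[OF m] by blast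
  have \<alpha>h: "\<alpha> \<le> h" using \<alpha> sh by linarith
  define L where "L t = (1 + cos (2 * pi * \<alpha> * real_of_int t)) / 2" for t :: int
  have L01: "0 \<le> L t" "L t \<le> 1" for t
  proof -
    have "0 \<le> 1 + cos (2 * pi * \<alpha> * real_of_int t)"
      using cos_ge_minus_one[of "2 * pi * \<alpha> * real_of_int t"] by linarith
    thus "0 \<le> L t" "L t \<le> 1" by (simp_all add: L_def)
  qed
  have pi4: "pi \<le> 4" using pi_less_4 by simp
  have Lshift: "\<bar>L (t + int (m i)) - L t\<bar> \<le> 4 * h / real (i + 1)" for t i
  proof -
    obtain z :: int where z: "\<bar>\<alpha> * real (m i) - z\<bar> \<le> 2 / (real (s + 1) * real (i + 1))"
      using near by blast
    let ?\<theta> = "2 * pi * \<alpha> * real_of_int t"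
    let ?x = "?\<theta> + 2 * pi * (\<alpha> * real (m i) - z)"
    have "cos (2 * pi * \<alpha> * real_of_int (t + int (m i))) = cos (?x + 2 * pi * real_of_int z)"
      by (simp add: algebra_simps)
    also have "\<dots> = cos ?x"
      unfolding cos_add[of ?x "2 * pi * real_of_int z"] cos_int_2pin sin_int_2pin by simp
    finally have "\<bar>L (t + int (m i)) - L t\<bar> = \<bar>cos ?x - cos ?\<theta>\<bar> / 2"
      unfolding L_def by (simp add: diff_divide_distrib[symmetric])
    also have "\<dots> \<le> \<bar>?x - ?\<theta>\<bar> / 2" by (intro divide_right_mono abs_cos_diff_le) auto
    also have "\<dots> = pi * \<bar>\<alpha> * real (m i) - z\<bar>" by (simp add: abs_mult)
    also have "\<dots> \<le> 4 * (2 / (real (s + 1) * real (i + 1)))"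
      using pi4 z by (intro mult_mono) auto
    also have "\<dots> = 4 * ((2 / real (s + 1)) / real (i + 1))" by simp
    also have "\<dots> \<le> 4 * (h / real (i + 1))"
      using sh by (intro mult_left_mono divide_right_mono) auto
    finally show ?thesis by simp
  qed
  have Lnear: "1 - L t \<le> 4 * h * R" if "\<bar>real_of_int t\<bar> \<le> R" for t
  proof -
    have "1 - L t \<le> \<bar>cos 0 - cos (2 * pi * \<alpha> * real_of_int t)\<bar> / 2"
      unfolding L_def by (simp add: field_simps)
    also have "\<dots> \<le> \<bar>0 - 2 * pi * \<alpha> * real_of_int t\<bar> / 2"
      by (intro divide_right_mono abs_cos_diff_le) auto
    also have "\<dots> = pi * \<alpha> * \<bar>real_of_int t\<bar>" using \<alpha> by (simp add: abs_mult)
    also have "\<dots> \<le> 4 * h * R"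
      using that pi4 \<alpha>h \<alpha> h by (intro mult_mono) auto
    finally show ?thesis .
  qed
  \<comment> \<open>Half a period of the weight, rounded to an integer.\<close>
  define N where "N = nat \<lfloor>1 / (2 * \<alpha>)\<rfloor>"
  have N: "\<bar>2 * \<alpha> * real N - 1\<bar> \<le> 2 * \<alpha>"
  proof -
    have p: "0 < 2 * \<alpha>" using \<alpha> by simp
    have Nf: "real N = real_of_int \<lfloor>1 / (2 * \<alpha>)\<rfloor>" unfolding N_def using p by simp
    have "real N \<le> 1 / (2 * \<alpha>)" "1 / (2 * \<alpha>) < real N + 1" unfolding Nf by (rule of_int_floor_le, rule floor_correct[THEN conjunct2, simplified])
    hence "2 * \<alpha> * real N \<le> 1" "1 < 2 * \<alpha> * (real N + 1)"
      using p by (simp_all add: field_simps)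
    thus ?thesis by (simp add: algebra_simps abs_le_iff)
  qed
  have Lfar: "L (t + int N) \<le> 4 * h * (R + 1)" if "\<bar>real_of_int t\<bar> \<le> R" for t
  proof -
    let ?x = "2 * pi * \<alpha> * real_of_int (t + int N)"
    have "L (t + int N) \<le> \<bar>cos ?x - cos pi\<bar> / 2"
      unfolding L_def cos_pi by (intro divide_right_mono) linarith+
    also have "\<dots> \<le> \<bar>?x - pi\<bar> / 2" by (intro divide_right_mono abs_cos_diff_le) auto
    also have "?x - pi = pi * (2 * \<alpha> * real_of_int t + (2 * \<alpha> * real N - 1))"
      by (simp add: algebra_simps)
    also have "\<bar>\<dots>\<bar> / 2 = pi * (\<bar>2 * \<alpha> * real_of_int t + (2 * \<alpha> * real N - 1)\<bar> / 2)"
      by (simp add: abs_mult)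
    also have "\<dots> \<le> 4 * (h * (R + 1))"
    proof (intro mult_mono pi4)
      have "\<bar>2 * \<alpha> * real_of_int t\<bar> \<le> 2 * \<alpha> * R"
        using that \<alpha> by (simp add: abs_mult)
      hence "\<bar>2 * \<alpha> * real_of_int t + (2 * \<alpha> * real N - 1)\<bar> \<le> 2 * \<alpha> * R + 2 * \<alpha>"
        using N by linarith
      hence "\<bar>2 * \<alpha> * real_of_int t + (2 * \<alpha> * real N - 1)\<bar> / 2 \<le> \<alpha> * (R + 1)"
        by (simp add: algebra_simps)
      also have "\<dots> \<le> h * (R + 1)" using \<alpha>h R0 by (intro mult_right_mono) auto
      finally show "\<bar>2 * \<alpha> * real_of_int t + (2 * \<alpha> * real N - 1)\<bar> / 2 \<le> h * (R + 1)" .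
    qed auto
    finally show ?thesis by (simp add: mult.assoc)
  qed
  show ?thesis
  proof (intro exI[of _ N] ballI)
    fix u v assume u: "u \<in> near_periodic m" and v: "v \<in> near_periodic m"
    define w where "w = shift_array (- int N) v"
    have w: "w \<in> near_periodic m" unfolding w_def using v by (rule near_periodic_shift)
    have wv: "shift_array (int N) w = v" unfolding w_def by simp
    define y where "y k = (1 - 4 * h) * (L (time_of k) * u k + (1 - L (time_of k)) * w k)" for k
    have bu: "\<bar>u k\<bar> \<le> 2" and bw: "\<bar>w k\<bar> \<le> 2" for k
      using u w unfolding near_periodic_def by blast+
    have convex: "\<bar>l * a + (1 - l) * b\<bar> \<le> c" if "0 \<le> l" "l \<le> 1" "\<bar>a\<bar> \<le> c" "\<bar>b\<bar> \<le> c" for a b c l :: real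
    proof -
      have "\<bar>l * a + (1 - l) * b\<bar> \<le> l * \<bar>a\<bar> + (1 - l) * \<bar>b\<bar>"
        using that by (metis abs_mult abs_of_nonneg abs_triangle_ineq diff_ge_0_iff_ge)
      also have "\<dots> \<le> l * c + (1 - l) * c" using that by (intro add_mono mult_left_mono) auto
      finally show ?thesis by (simp add: algebra_simps)
    qed
    have mix: "\<bar>L (time_of k) * u k + (1 - L (time_of k)) * w k\<bar> \<le> 2" for k
      by (rule convex[OF L01 bu bw])
    have close: "\<bar>y k - a\<bar> \<le> 8 * h + 4 * q"
      if "\<bar>L (time_of k) * u k + (1 - L (time_of k)) * w k - a\<bar> \<le> 4 * q" for k a q
    proof -
      have "y k - a = (L (time_of k) * u k + (1 - L (time_of k)) * w k - a)
          - 4 * h * (L (time_of k) * u k + (1 - L (time_of k)) * w k)"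
        unfolding y_def by (simp add: algebra_simps)
      moreover have "\<bar>4 * h * (L (time_of k) * u k + (1 - L (time_of k)) * w k)\<bar> \<le> 4 * h * 2"
        using mix[of k] h by (simp add: abs_mult)
      ultimately show ?thesis using that by linarith
    qed
    have yW: "y \<in> near_periodic m"
      unfolding near_periodic_def
    proof (intro CollectI allI conjI impI)
      fix k
      have "\<bar>y k\<bar> \<le> (1 - 4 * h) * 2"
        unfolding y_def abs_mult using mix[of k] h by (intro mult_mono) auto
      also have "\<dots> \<le> 2" using h by simp
      finally show "\<bar>y k\<bar> \<le> 2" .
      fix i assume i: "row_of k \<le> i"
      let ?k = "cell_at (row_of k) (time_of k + int (m i))"
      let ?l = "L (time_of k)" and ?l' = "L (time_of k + int (m i))"
      have du: "\<bar>u ?k - u k\<bar> \<le> 4 / real (i + 1)" and dw: "\<bar>w ?k - w k\<bar> \<le> 4 / real (i + 1)"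
        using u w i unfolding near_periodic_def shift_array_def by blast+
      have "shift_array (int (m i)) y k - y k =
          (1 - 4 * h) * ((?l' * (u ?k - u k) + (1 - ?l') * (w ?k - w k)) + (?l' - ?l) * (u k - w k))"
        unfolding shift_array_def y_def by (simp add: algebra_simps)
      also have "\<bar>\<dots>\<bar> \<le> (1 - 4 * h) * (4 / real (i + 1) + 4 * h / real (i + 1) * 4)"
      proof -
        have "\<bar>(?l' - ?l) * (u k - w k)\<bar> \<le> 4 * h / real (i + 1) * 4"
          unfolding abs_mult using Lshift bu[of k] bw[of k] h by (intro mult_mono) auto
        moreover have "\<bar>?l' * (u ?k - u k) + (1 - ?l') * (w ?k - w k)\<bar> \<le> 4 / real (i + 1)"
          by (rule convex[OF L01 du dw])
        ultimately have "\<bar>?l' * (u ?k - u k) + (1 - ?l') * (w ?k - w k) + (?l' - ?l) * (u k - w k)\<bar>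
            \<le> 4 / real (i + 1) + 4 * h / real (i + 1) * 4"
          by (intro order_trans[OF abs_triangle_ineq[of "?l' * (u ?k - u k) + (1 - ?l') * (w ?k - w k)"]]
              add_mono)
        thus ?thesis
          unfolding abs_mult[of "1 - 4 * h"] using h by (intro mult_mono) auto
      qed
      also have "\<dots> = (1 - 16 * h\<^sup>2) * (4 / real (i + 1))"
        by (simp add: algebra_simps power2_eq_square add_divide_distrib diff_divide_distrib)
      also have "\<dots> \<le> 1 * (4 / real (i + 1))"
        by (intro mult_right_mono) auto
      finally show "\<bar>shift_array (int (m i)) y k - y k\<bar> \<le> 4 / real (i + 1)" by simp
    qed
    show "\<exists>y\<in>near_periodic m. \<forall>k\<le>K. \<bar>y k - u k\<bar> < e \<and> \<bar>shift_array (int N) y k - v k\<bar> < e"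
    proof (intro bexI[OF _ yW] allI impI conjI)
      fix k assume k: "k \<le> K"
      have "\<bar>L (time_of k) * u k + (1 - L (time_of k)) * w k - u k\<bar>
          = \<bar>(1 - L (time_of k)) * (w k - u k)\<bar>" by (simp add: algebra_simps)
      also have "\<dots> \<le> (4 * h * R) * 4"
        unfolding abs_mult using Lnear[OF R[OF k]] L01 bu[of k] bw[of k] R0 h
        by (intro mult_mono) auto
      finally have "\<bar>y k - u k\<bar> \<le> 8 * h + 4 * (4 * h * R)"
        by (intro close) simp
      also have "\<dots> \<le> 8 * h + 16 * h * (R + 1)" using h by (simp add: algebra_simps)
      finally show "\<bar>y k - u k\<bar> < e" using he by linarith
      let ?k = "cell_at (row_of k) (time_of k + int N)"
      have wk: "w ?k = v k" using wv by (simp add: shift_array_def fun_eq_iff)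
      have "\<bar>L (time_of ?k) * u ?k + (1 - L (time_of ?k)) * w ?k - v k\<bar>
          = \<bar>L (time_of k + int N) * (u ?k - w ?k)\<bar>"
        unfolding wk[symmetric] by (simp add: algebra_simps)
      also have "\<dots> \<le> (4 * h * (R + 1)) * 4"
        unfolding abs_mult using Lfar[OF R[OF k]] L01 bu[of ?k] bw[of ?k] R0 h
        by (intro mult_mono) auto
      finally have "\<bar>y ?k - v k\<bar> \<le> 8 * h + 4 * (4 * h * (R + 1))"
        by (intro close) simp
      thus "\<bar>shift_array (int N) y k - v k\<bar> < e" using he unfolding shift_array_def by simp
    qed
  qed
qed

section \<open>Weak mixing\<close>

text \<open>
  For each \<open>d\<close> in a countable dense set and each \<open>p\<close>, the points that come \<open>1 / (p + 1)\<close>-close to \<open>d\<close> under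
  some \<open>F N\<close> form a set that is open since each \<open>F N\<close> is continuous, and dense by the gluing hypothesis.
  Baire's theorem yields a point in all these sets.
\<close>

lemma dense_forward_orbit:
  fixes Z :: "'a::{metric_space, second_countable_topology} set"
  assumes "compact Z" "Z \<noteq> {}"
    and cont: "\<And>N. continuous_on Z (F N)"
    and glue: "\<And>a b e. a \<in> Z \<Longrightarrow> b \<in> Z \<Longrightarrow> e > 0 \<Longrightarrow>
      \<exists>N::nat. \<exists>z\<in>Z. dist z a < e \<and> dist (F N z) b < e"
  shows "\<exists>z\<in>Z. Z \<subseteq> closure (range (\<lambda>N. F N z))"
proof -
  obtain D where D: "countable D" "D \<subseteq> Z" "Z \<subseteq> closure D"
    using separable by blast
  define U where "U d p = {z \<in> Z. \<exists>N. dist (F N z) d < 1 / real (p + 1)}" for d and p :: nat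
  let ?X = "top_of_set Z"
  let ?\<G> = "(\<lambda>(d, p). U d p) ` (D \<times> UNIV)"
  have "?X closure_of \<Inter>?\<G> = topspace ?X"
  proof (rule Baire_category)
    have "compact_space ?X" using assms(1) by (simp add: compact_space_subtopology)
    moreover have haus: "Hausdorff_space ?X" by (simp add: Hausdorff_space_subtopology)
    ultimately show "completely_metrizable_space ?X \<or> locally_compact_space ?X \<and> regular_space ?X"
      by (simp add: compact_imp_locally_compact_space compact_Hausdorff_or_regular_imp_normal_space
          normal_t1_imp_regular_space Hausdorff_imp_t1_space)
    show "countable ?\<G>" using D(1) by auto
    fix T assume "T \<in> ?\<G>"
    then obtain d p where T: "T = U d p" and d: "d \<in> D" by auto
    have "openin ?X T"
    proof -
      have "openin ?X (Z \<inter> F N -` ball d (1 / real (p + 1)))" for N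
        by (rule continuous_openin_preimage_gen[OF cont]) simp
      hence "openin ?X (\<Union>N. Z \<inter> F N -` ball d (1 / real (p + 1)))" by blast
      also have "(\<Union>N. Z \<inter> F N -` ball d (1 / real (p + 1))) = T"
        unfolding T U_def by (auto simp: dist_commute)
      finally show ?thesis .
    qed
    moreover have "Z \<subseteq> closure T"
    proof
      fix a assume a: "a \<in> Z"
      show "a \<in> closure T"
        unfolding closure_approachable
      proof (intro allI impI)
        fix e :: real assume "e > 0"
        hence "min e (1 / real (p + 1)) > 0" by simp
        from glue[OF a _ this, of d] D(2) d obtain N z
          where "z \<in> Z" "dist z a < e" "dist (F N z) d < 1 / real (p + 1)" by auto
        thus "\<exists>y\<in>T. dist y a < e" unfolding T U_def by blast
      qed
    qed
    ultimately show "openin ?X T \<and> ?X closure_of T = topspace ?X"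
      by (auto simp: closure_of_subtopology T U_def Int_absorb1 intro: set_mp dest: closure_subset[THEN subsetD])
  qed
  hence closure: "Z \<inter> closure (Z \<inter> \<Inter>?\<G>) = Z"
    unfolding closure_of_subtopology topspace_euclidean_subtopology euclidean_closure_of .
  have "\<Inter>?\<G> \<inter> Z \<noteq> {}"
  proof
    assume "\<Inter>?\<G> \<inter> Z = {}"
    hence "Z \<inter> \<Inter>?\<G> = {}" by blast
    with closure \<open>Z \<noteq> {}\<close> show False by simp
  qed
  then obtain z where z: "z \<in> Z" and all: "\<And>d p. d \<in> D \<Longrightarrow> z \<in> U d p" by auto
  have "D \<subseteq> closure (range (\<lambda>N. F N z))"
  proof
    fix d assume d: "d \<in> D"
    show "d \<in> closure (range (\<lambda>N. F N z))"
      unfolding closure_approachable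
    proof (intro allI impI)
      fix e :: real assume "e > 0"
      then obtain p :: nat where p: "1 / real (p + 1) < e"
        using nat_approx_posE[of e] by (metis Suc_eq_plus1)
      from all[OF d, of p] obtain N where "dist (F N z) d < 1 / real (p + 1)"
        unfolding U_def by blast
      thus "\<exists>y\<in>range (\<lambda>N. F N z). dist y d < e" using p by (meson less_trans rangeI)
    qed
  qed
  hence "closure D \<subseteq> closure (range (\<lambda>N. F N z))" by (simp add: closure_minimal)
  with D(3) z show ?thesis by blast
qed

lemma funpow_map_prod:
  fixes f :: "'a \<Rightarrow> 'a" and g :: "'b \<Rightarrow> 'b"
  shows "(map_prod f g ^^ j) z = ((f ^^ j) (fst z), (g ^^ j) (snd z))"
  by (induction j) simp_all

text \<open>
  The time \<open>N\<close> produced by gluing is the same for all pairs of arrays, so both components of a point of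
  the product can be steered at once.
\<close>

lemma weakly_mixing_near_periodic:
  assumes m: "fast_growing m"
  shows "weakly_mixing (near_periodic m) (shift_array 1)"
  unfolding weakly_mixing_def transitive_def
proof -
  let ?Y = "near_periodic m" and ?S = "map_prod (shift_array 1) (shift_array 1)"
  have "(\<lambda>_. 0) \<in> ?Y" by (simp add: near_periodic_def shift_array_def)
  define F where "F N = (\<lambda>z. (shift_array (int N) (fst z), shift_array (int N) (snd z)))" for N
  have "\<exists>z\<in>?Y \<times> ?Y. ?Y \<times> ?Y \<subseteq> closure (range (\<lambda>N. F N z))"
  proof (rule dense_forward_orbit)
    show "compact (?Y \<times> ?Y)" by (intro compact_Times compact_near_periodic)
    show "?Y \<times> ?Y \<noteq> {}" using \<open>(\<lambda>_. 0) \<in> ?Y\<close> by blast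
    show "continuous_on (?Y \<times> ?Y) (F N)" for N
      unfolding F_def
      by (intro continuous_on_Pair continuous_on_compose2[OF continuous_on_shift[of UNIV]]
          continuous_intros) auto
    fix a b and e :: real assume a: "a \<in> ?Y \<times> ?Y" and b: "b \<in> ?Y \<times> ?Y" and "e > 0"
    then obtain K d where d: "d > 0"
      and close: "\<And>x y :: nat \<Rightarrow> real. (\<And>k. k \<le> K \<Longrightarrow> \<bar>x k - y k\<bar> \<le> d) \<Longrightarrow> dist x y < e/2"
      using dist_fun_less_from_coordinates[of "e/2"] by (metis half_gt_zero)
    from near_periodic_glue[OF m d, of K] obtain N :: nat where
      N: "\<And>u v. u \<in> ?Y \<Longrightarrow> v \<in> ?Y \<Longrightarrow> \<exists>y\<in>?Y. \<forall>k\<le>K. \<bar>y k - u k\<bar> < d \<and> \<bar>shift_array (int N) y k - v k\<bar> < d"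
      by blast
    have *: "\<exists>y\<in>?Y. dist y u < e/2 \<and> dist (shift_array (int N) y) v < e/2"
      if "u \<in> ?Y" "v \<in> ?Y" for u v
      using N[OF that] by (meson close less_imp_le)
    have pair: "dist p q < e" if "dist (fst p) (fst q) < e/2" "dist (snd p) (snd q) < e/2"
      for p q :: "(nat \<Rightarrow> real) \<times> (nat \<Rightarrow> real)"
    proof -
      have "dist p q \<le> dist (fst p) (fst q) + dist (snd p) (snd q)"
        by (cases p, cases q) (simp add: dist_Pair_Pair sqrt_sum_squares_le_sum)
      thus ?thesis using that by linarith
    qed
    obtain y1 where y1: "y1 \<in> ?Y" "dist y1 (fst a) < e/2" "dist (shift_array (int N) y1) (fst b) < e/2"
      using *[of "fst a" "fst b"] a b by auto
    obtain y2 where y2: "y2 \<in> ?Y" "dist y2 (snd a) < e/2" "dist (shift_array (int N) y2) (snd b) < e/2"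
      using *[of "snd a" "snd b"] a b by auto
    show "\<exists>N. \<exists>z\<in>?Y \<times> ?Y. dist z a < e \<and> dist (F N z) b < e"
      using y1 y2 by (intro exI[of _ N] bexI[of _ "(y1, y2)"]) (auto simp: F_def intro!: pair)
  qed
  then obtain z where z: "z \<in> ?Y \<times> ?Y" "?Y \<times> ?Y \<subseteq> closure (range (\<lambda>N. F N z))" by blast
  have "range (\<lambda>N. F N z) \<subseteq> range (\<lambda>k. int_iterate (?Y \<times> ?Y) ?S k z)"
  proof
    fix w assume "w \<in> range (\<lambda>N. F N z)"
    then obtain N where "w = F N z" by blast
    hence "w = int_iterate (?Y \<times> ?Y) ?S (int N) z"
      by (simp add: int_iterate_def F_def funpow_map_prod funpow_shift)
    thus "w \<in> range (\<lambda>k. int_iterate (?Y \<times> ?Y) ?S k z)" by blast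
  qed
  hence "?Y \<times> ?Y \<subseteq> closure (range (\<lambda>k. int_iterate (?Y \<times> ?Y) ?S k z))"
    using z(2) closure_mono by blast
  with z(1) show "\<exists>z\<in>?Y \<times> ?Y. ?Y \<times> ?Y \<subseteq> closure (range (\<lambda>k. int_iterate (?Y \<times> ?Y) ?S k z))"
    by blast
qed

section \<open>Smoothing an observable along the orbits\<close>

lemma measure_preserving_funpow:
  assumes "f \<in> measurable M M" "distr M M f = M"
  shows "f ^^ j \<in> measurable M M" "distr M M (f ^^ j) = M"
proof -
  have "f ^^ j \<in> measurable M M \<and> distr M M (f ^^ j) = M"
  proof (induction j)
    case 0 show ?case by (simp add: id_def distr_id)
  next
    case (Suc j)
    hence "distr M M (f \<circ> (f ^^ j)) = distr (distr M M (f ^^ j)) M f"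
      using assms by (intro distr_distr[symmetric]) auto
    also have "\<dots> = M" using Suc assms by simp
    finally show ?case
      using measurable_comp[OF conjunct1[OF Suc] assms(1)] by (simp only: funpow.simps simp_thms)
  qed
  thus "f ^^ j \<in> measurable M M" "distr M M (f ^^ j) = M" by auto
qed

locale mps = prob_space M for M :: "'a measure" +
  fixes T :: "'a \<Rightarrow> 'a"
  assumes invertible: "invertible_mps M T"
begin

abbreviation iter :: "int \<Rightarrow> 'a \<Rightarrow> 'a" where
  "iter k \<equiv> int_iterate (space M) T k"

lemma iter_measurable [measurable]: "iter k \<in> measurable M M"
  and distr_iter: "distr M M (iter k) = M"
proof -
  have *: "T \<in> measurable M M" "distr M M T = M"
    "the_inv_into (space M) T \<in> measurable M M" "distr M M (the_inv_into (space M) T) = M"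
    using invertible by (auto simp: invertible_mps_def)
  show "iter k \<in> measurable M M" "distr M M (iter k) = M"
    unfolding int_iterate_def
    using measure_preserving_funpow[OF *(1,2)] measure_preserving_funpow[OF *(3,4)] by simp_all
qed

lemma iter_space: "x \<in> space M \<Longrightarrow> iter k x \<in> space M"
  by (rule measurable_space[OF iter_measurable])

lemma T_space: "x \<in> space M \<Longrightarrow> T x \<in> space M"
  using invertible by (auto simp: invertible_mps_def dest: measurable_space)

lemma iter_0 [simp]: "iter 0 x = x"
  and iter_1: "iter 1 x = T x"
  and iter_nat: "iter (int j) x = (T ^^ j) x"
  by (simp_all add: int_iterate_def)

lemma iter_T:
  assumes "x \<in> space M"
  shows "iter k (T x) = iter (k + 1) x"
proof (cases "k \<ge> 0")
  case True
  then obtain j where k: "k = int j" using nonneg_int_cases by blast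
  have "nat (k + 1) = Suc j" using k by simp
  thus ?thesis using k by (simp add: int_iterate_def funpow_swap1)
next
  case False
  define j where "j = nat (- k - 1)"
  have k: "k = - 1 - int j" using False unfolding j_def by simp
  have inv: "the_inv_into (space M) T (T x) = x"
    using invertible assms by (simp add: invertible_mps_def bij_betw_def the_inv_into_f_f)
  have "nat (- k) = Suc j" using k by simp
  hence "iter k (T x) = (the_inv_into (space M) T ^^ Suc j) (T x)"
    using False unfolding int_iterate_def by simp
  also have "\<dots> = (the_inv_into (space M) T ^^ j) x"
    by (simp only: funpow_Suc_right comp_apply inv)
  also have "\<dots> = iter (k + 1) x"
    using k by (cases "j = 0") (simp_all add: int_iterate_def)
  finally show ?thesis .
qed

lemma iter_add:
  assumes "x \<in> space M"
  shows "iter (a + b) x = iter a (iter b x)"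
  using assms
proof (induction b arbitrary: x rule: int_induct[where k = 0])
  case (step1 b)
  have "iter (a + (b + 1)) x = iter (a + b) (T x)"
    using step1.prems by (simp add: iter_T add.assoc)
  also have "\<dots> = iter a (iter b (T x))" using step1 T_space by blast
  finally show ?case using step1.prems by (simp add: iter_T)
next
  case (step2 b)
  obtain x' where x': "x' \<in> space M" "x = T x'"
    using invertible step2.prems by (auto simp: invertible_mps_def bij_betw_def)
  have "iter (a + (b - 1)) x = iter (a + b) x'" using x' by (simp add: iter_T)
  also have "\<dots> = iter a (iter b x')" using step2 x' by blast
  finally show ?case using x' by (simp add: iter_T)
qed simp

text \<open>
  Statements known almost everywhere can be assumed to hold along whole orbits: discard the countably
  many translates of the exceptional null set.
\<close>

lemma invariant_core:
  assumes "AE x in M. P x"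
  obtains X where "X \<in> sets M" "AE x in M. x \<in> X" "\<And>x. x \<in> X \<Longrightarrow> P x"
    "\<And>x k. x \<in> X \<Longrightarrow> iter k x \<in> X"
proof -
  obtain N where N: "{x \<in> space M. \<not> P x} \<subseteq> N" "emeasure M N = 0" "N \<in> sets M"
    using AE_E[OF assms] by blast
  define X where "X = {x \<in> space M. \<forall>k. iter k x \<in> space M - N}"
  show thesis
  proof
    show "X \<in> sets M" unfolding X_def using N(3) by measurable
    have "AE x in M. iter k x \<in> space M - N" for k
    proof -
      have "AE x in distr M M (iter k). x \<in> space M - N"
        unfolding distr_iter using N(2,3) by (intro AE_I[of _ _ N]) auto
      thus ?thesis using N(3) by (subst (asm) AE_distr_iff) auto
    qed
    hence "AE x in M. \<forall>k. iter k x \<in> space M - N" by (simp add: AE_all_countable)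
    thus "AE x in M. x \<in> X" unfolding X_def by auto
    show "P x" if "x \<in> X" for x
      using that N(1) unfolding X_def by (force dest: spec[of _ 0])
    show "iter k x \<in> X" if "x \<in> X" for x k
      using that unfolding X_def by (simp add: iter_space iter_add[symmetric])
  qed
qed

lemma integral_iter:
  fixes f :: "'a \<Rightarrow> real"
  assumes [measurable]: "f \<in> borel_measurable M"
  shows "(\<integral>x. f (iter k x) \<partial>M) = (\<integral>x. f x \<partial>M)"
proof -
  have "(\<integral>x. f (iter k x) \<partial>M) = (\<integral>x. f x \<partial>distr M M (iter k))"
    by (rule integral_distr[symmetric]) measurable
  thus ?thesis by (simp add: distr_iter)
qed

text \<open>
  The bound 2 leaves room for \<open>arctan\<close>, through which an arbitrary real observable is made bounded.
\<close>

definition bounded_observable :: "('a \<Rightarrow> real) \<Rightarrow> bool" where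
  "bounded_observable f \<longleftrightarrow> f \<in> borel_measurable M \<and> (\<forall>x. \<bar>f x\<bar> \<le> 2)"

lemma integrable_displacement:
  assumes "bounded_observable f" "bounded_observable g"
  shows "integrable M (\<lambda>x. \<bar>f (iter j x) - g (iter k x)\<bar>)"
proof (rule integrable_const_bound[where B = 4])
  have [measurable]: "f \<in> borel_measurable M" "g \<in> borel_measurable M"
    using assms by (auto simp: bounded_observable_def)
  show "(\<lambda>x. \<bar>f (iter j x) - g (iter k x)\<bar>) \<in> borel_measurable M" by measurable
  have "\<bar>f a - g b\<bar> \<le> 4" for a b
  proof -
    have "\<bar>f a\<bar> \<le> 2" "\<bar>g b\<bar> \<le> 2" using assms unfolding bounded_observable_def by blast+
    thus ?thesis by linarith
  qed
  thus "AE x in M. norm \<bar>f (iter j x) - g (iter k x)\<bar> \<le> 4" by simp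
qed

text \<open>
  The \<open>L\<^sup>1\<close> distance between \<open>f\<close> and its translate; rigidity makes it small for suitable \<open>p\<close>.
\<close>

definition displacement :: "int \<Rightarrow> ('a \<Rightarrow> real) \<Rightarrow> real" where
  "displacement p f = (\<integral>x. \<bar>f (iter p x) - f x\<bar> \<partial>M)"

lemma displacement_nonneg: "0 \<le> displacement p f"
  unfolding displacement_def by simp

lemma displacement_multiple:
  assumes f: "bounded_observable f"
  shows "displacement (int l * p) f \<le> real l * displacement p f"
proof (induction l)
  case 0 show ?case by (simp add: displacement_def)
next
  case (Suc l)
  have int: "integrable M (\<lambda>x. \<bar>f (iter j x) - f (iter k x)\<bar>)" for j k
    using f f by (rule integrable_displacement)
  have [measurable]: "f \<in> borel_measurable M" using f by (simp add: bounded_observable_def)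
  have "displacement (int (Suc l) * p) f
      \<le> (\<integral>x. \<bar>f (iter (p + int l * p) x) - f (iter (int l * p) x)\<bar> + \<bar>f (iter (int l * p) x) - f (iter 0 x)\<bar> \<partial>M)"
    unfolding displacement_def
    using int[of "int (Suc l) * p" 0]
    by (intro integral_mono Bochner_Integration.integrable_add int) (auto simp: algebra_simps)
  also have "\<dots> = (\<integral>x. \<bar>f (iter (p + int l * p) x) - f (iter (int l * p) x)\<bar> \<partial>M) + displacement (int l * p) f"
    unfolding displacement_def by (subst Bochner_Integration.integral_add[OF int int]) simp
  also have "(\<integral>x. \<bar>f (iter (p + int l * p) x) - f (iter (int l * p) x)\<bar> \<partial>M)
      = (\<integral>x. \<bar>f (iter p (iter (int l * p) x)) - f (iter (int l * p) x)\<bar> \<partial>M)"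
    by (intro Bochner_Integration.integral_cong refl) (simp add: iter_add)
  also have "\<dots> = displacement p f"
    unfolding displacement_def by (rule integral_iter) measurable
  finally show ?case using Suc by (simp add: algebra_simps)
qed

definition orbit_average :: "nat \<Rightarrow> int \<Rightarrow> ('a \<Rightarrow> real) \<Rightarrow> 'a \<Rightarrow> real" where
  "orbit_average L p f x = (\<Sum>l<L. f (iter (int l * p) x)) / real L"

lemma bounded_observable_orbit_average:
  assumes f: "bounded_observable f" and L: "L > 0"
  shows "bounded_observable (orbit_average L p f)"
  unfolding bounded_observable_def
proof (intro conjI allI)
  have [measurable]: "f \<in> borel_measurable M" using f by (simp add: bounded_observable_def)
  show "orbit_average L p f \<in> borel_measurable M"
    unfolding orbit_average_def[abs_def] by measurable
  fix x
  have "\<bar>\<Sum>l<L. f (iter (int l * p) x)\<bar> \<le> (\<Sum>l<L. \<bar>f (iter (int l * p) x)\<bar>)" by (rule sum_abs)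
  also have "\<dots> \<le> (\<Sum>l<L. 2)" using f by (intro sum_mono) (simp add: bounded_observable_def)
  finally show "\<bar>orbit_average L p f x\<bar> \<le> 2"
    unfolding orbit_average_def using L by (simp add: divide_le_eq)
qed

text \<open>
  Translating the average by \<open>p\<close> exchanges one of its \<open>L\<close> terms only.
\<close>

lemma orbit_average_near_period:
  assumes f: "bounded_observable f" and L: "L > 0" and x: "x \<in> space M"
  shows "\<bar>orbit_average L p f (iter p x) - orbit_average L p f x\<bar> \<le> 4 / real L"
proof -
  let ?a = "\<lambda>l. f (iter (int l * p) x)"
  have "orbit_average L p f (iter p x) - orbit_average L p f x = (\<Sum>l<L. ?a (Suc l) - ?a l) / real L"
    unfolding orbit_average_def
    by (simp add: iter_add[OF x, symmetric] sum_subtractf diff_divide_distrib algebra_simps)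
  also have "\<dots> = (?a L - ?a 0) / real L" by (simp only: sum_lessThan_telescope[of ?a L])
  also have "\<bar>\<dots>\<bar> \<le> 4 / real L"
  proof -
    have "\<bar>?a L\<bar> \<le> 2" "\<bar>?a 0\<bar> \<le> 2" using f unfolding bounded_observable_def by blast+
    hence "\<bar>?a L - ?a 0\<bar> \<le> 4" by linarith
    thus ?thesis by (simp add: divide_right_mono)
  qed
  finally show ?thesis .
qed

text \<open>
  A bound on the variation under another translation \<open>q\<close> passes to the average, since the
  translations commute. Thus later averaging steps preserve what the earlier ones have achieved.
\<close>

lemma orbit_average_contracts:
  assumes L: "L > 0" and x: "x \<in> space M"
    and le: "\<And>y. y \<in> space M \<Longrightarrow> \<bar>f (iter q y) - f y\<bar> \<le> d"
  shows "\<bar>orbit_average L p f (iter q x) - orbit_average L p f x\<bar> \<le> d"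
proof -
  have "orbit_average L p f (iter q x) - orbit_average L p f x
      = (\<Sum>l<L. f (iter q (iter (int l * p) x)) - f (iter (int l * p) x)) / real L"
    unfolding orbit_average_def
    by (simp add: iter_add[OF x, symmetric] sum_subtractf diff_divide_distrib add.commute)
  also have "\<bar>\<dots>\<bar> \<le> (\<Sum>l<L. \<bar>f (iter q (iter (int l * p) x)) - f (iter (int l * p) x)\<bar>) / real L"
    by (simp add: divide_right_mono sum_abs)
  also have "\<dots> \<le> (\<Sum>l<L. d) / real L"
    using le x by (intro divide_right_mono sum_mono) (auto simp: iter_space)
  also have "\<dots> = d" using L by simp
  finally show ?thesis .
qed

text \<open>
  The analogue in \<open>L\<^sup>1\<close>: averaging does not increase any displacement, so that the displacements of
  the initial observable control all steps of the smoothing.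
\<close>

lemma displacement_orbit_average:
  assumes f: "bounded_observable f" and L: "L > 0"
  shows "displacement q (orbit_average L p f) \<le> displacement q f"
proof -
  have [measurable]: "f \<in> borel_measurable M" using f by (simp add: bounded_observable_def)
  have int: "integrable M (\<lambda>x. \<bar>f (iter j x) - f (iter k x)\<bar>)" for j k
    using f f by (rule integrable_displacement)
  have "displacement q (orbit_average L p f)
      \<le> (\<integral>x. (\<Sum>l<L. \<bar>f (iter (q + int l * p) x) - f (iter (int l * p) x)\<bar>) / real L \<partial>M)"
    unfolding displacement_def
  proof (rule integral_mono)
    show "integrable M (\<lambda>x. \<bar>orbit_average L p f (iter q x) - orbit_average L p f x\<bar>)"
      using integrable_displacement[OF bounded_observable_orbit_average[OF f L]
          bounded_observable_orbit_average[OF f L], of p q p 0] by simp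
    show "integrable M (\<lambda>x. (\<Sum>l<L. \<bar>f (iter (q + int l * p) x) - f (iter (int l * p) x)\<bar>) / real L)"
      by (intro integrable_divide Bochner_Integration.integrable_sum int)
    fix x assume x: "x \<in> space M"
    have "orbit_average L p f (iter q x) - orbit_average L p f x
      = (\<Sum>l<L. f (iter (q + int l * p) x) - f (iter (int l * p) x)) / real L"
      unfolding orbit_average_def
      by (simp add: iter_add[OF x, symmetric] sum_subtractf diff_divide_distrib add.commute)
    also have "\<bar>\<dots>\<bar> \<le> (\<Sum>l<L. \<bar>f (iter (q + int l * p) x) - f (iter (int l * p) x)\<bar>) / real L"
      by (simp add: divide_right_mono sum_abs)
    finally show "\<bar>orbit_average L p f (iter q x) - orbit_average L p f x\<bar> \<le> \<dots>" .
  qed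
  also have "\<dots> = (\<Sum>l<L. \<integral>x. \<bar>f (iter (q + int l * p) x) - f (iter (int l * p) x)\<bar> \<partial>M) / real L"
    by (simp add: Bochner_Integration.integral_sum int)
  also have "(\<lambda>l. \<integral>x. \<bar>f (iter (q + int l * p) x) - f (iter (int l * p) x)\<bar> \<partial>M)
      = (\<lambda>l. displacement q f)"
  proof
    fix l
    have "(\<integral>x. \<bar>f (iter (q + int l * p) x) - f (iter (int l * p) x)\<bar> \<partial>M)
        = (\<integral>x. \<bar>f (iter q (iter (int l * p) x)) - f (iter (int l * p) x)\<bar> \<partial>M)"
      by (intro Bochner_Integration.integral_cong refl) (simp add: iter_add)
    also have "\<dots> = displacement q f"
      unfolding displacement_def by (rule integral_iter) measurable
    finally show "(\<integral>x. \<bar>f (iter (q + int l * p) x) - f (iter (int l * p) x)\<bar> \<partial>M) = displacement q f" .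
  qed
  finally show ?thesis using L by simp
qed

text \<open>
  Each term of the average is a translate by \<open>l * p\<close> with \<open>l < L\<close>, at distance at most \<open>l\<close> times
  the displacement by \<open>p\<close>.
\<close>

lemma orbit_average_L1:
  assumes f: "bounded_observable f" and L: "L > 0"
  shows "(\<integral>x. \<bar>orbit_average L p f x - f x\<bar> \<partial>M) \<le> real L * displacement p f"
proof -
  have int: "integrable M (\<lambda>x. \<bar>f (iter j x) - f x\<bar>)" for j
    using integrable_displacement[OF f f, of j 0] by simp
  have "(\<integral>x. \<bar>orbit_average L p f x - f x\<bar> \<partial>M)
      \<le> (\<integral>x. (\<Sum>l<L. \<bar>f (iter (int l * p) x) - f x\<bar>) / real L \<partial>M)"
  proof (rule integral_mono)
    show "integrable M (\<lambda>x. \<bar>orbit_average L p f x - f x\<bar>)"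
      using integrable_displacement[OF bounded_observable_orbit_average[OF f L] f, of p 0 0] by simp
    show "integrable M (\<lambda>x. (\<Sum>l<L. \<bar>f (iter (int l * p) x) - f x\<bar>) / real L)"
      by (intro integrable_divide Bochner_Integration.integrable_sum int)
    fix x
    have "orbit_average L p f x - f x = (\<Sum>l<L. f (iter (int l * p) x) - f x) / real L"
      unfolding orbit_average_def using L by (simp add: sum_subtractf diff_divide_distrib)
    also have "\<bar>\<dots>\<bar> \<le> (\<Sum>l<L. \<bar>f (iter (int l * p) x) - f x\<bar>) / real L"
      by (simp add: divide_right_mono sum_abs)
    finally show "\<bar>orbit_average L p f x - f x\<bar> \<le> \<dots>" .
  qed
  also have "\<dots> = (\<Sum>l<L. displacement (int l * p) f) / real L"
    by (simp add: Bochner_Integration.integral_sum int displacement_def)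
  also have "\<dots> \<le> (\<Sum>l<L. real L * displacement p f) / real L"
  proof (intro divide_right_mono sum_mono)
    fix l assume "l \<in> {..<L}"
    hence "real l * displacement p f \<le> real L * displacement p f"
      by (intro mult_right_mono displacement_nonneg) auto
    thus "displacement (int l * p) f \<le> real L * displacement p f"
      using displacement_multiple[OF f, of l p] by linarith
  qed simp
  also have "\<dots> = real L * displacement p f" using L by simp
  finally show ?thesis .
qed

text \<open>
  Averaging starts at \<open>i = c\<close>: the total distance from \<open>g\<close> then is a tail of a convergent series, small
  for large \<open>c\<close>.
\<close>

primrec smoothing :: "(nat \<Rightarrow> nat) \<Rightarrow> ('a \<Rightarrow> real) \<Rightarrow> nat \<Rightarrow> nat \<Rightarrow> 'a \<Rightarrow> real" where
  "smoothing m g c 0 = g"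
| "smoothing m g c (Suc r) = orbit_average (c + r + 1) (int (m (c + r))) (smoothing m g c r)"

lemma bounded_observable_smoothing:
  "bounded_observable g \<Longrightarrow> bounded_observable (smoothing m g c r)"
  by (induction r) (auto intro: bounded_observable_orbit_average)

text \<open>
  The step for time \<open>m i\<close> creates the bound, and the following steps keep it.
\<close>

lemma smoothing_near_period:
  assumes g: "bounded_observable g" and i: "c \<le> i" "i < c + r" and x: "x \<in> space M"
  shows "\<bar>smoothing m g c r (iter (int (m i)) x) - smoothing m g c r x\<bar> \<le> 4 / real (i + 1)"
  using i(2) x
proof (induction r arbitrary: x)
  case 0 thus ?case using i(1) by simp
next
  case (Suc r)
  show ?case
  proof (cases "i = c + r")
    case True
    thus ?thesis
      using orbit_average_near_period[OF bounded_observable_smoothing[OF g] _ Suc.prems(2),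
          where L = "c + r + 1"] by simp
  next
    case False
    with Suc.prems have "i < c + r" by simp
    hence "\<And>y. y \<in> space M \<Longrightarrow>
        \<bar>smoothing m g c r (iter (int (m i)) y) - smoothing m g c r y\<bar> \<le> 4 / real (i + 1)"
      by (rule Suc.IH)
    thus ?thesis
      unfolding smoothing.simps by (intro orbit_average_contracts Suc.prems(2)) simp_all
  qed
qed

lemma smoothing_step_L1:
  assumes g: "bounded_observable g"
    and fast: "\<And>i. real (i + 1) * displacement (int (m i)) g \<le> (1/2)^i"
  shows "(\<integral>x. \<bar>smoothing m g c (Suc r) x - smoothing m g c r x\<bar> \<partial>M) \<le> (1/2)^(c + r)"
proof -
  have "displacement q (smoothing m g c r) \<le> displacement q g" for q
  proof (induction r)
    case (Suc r)
    thus ?case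
      using displacement_orbit_average[OF bounded_observable_smoothing[OF g], where L = "c + r + 1"]
      by (simp del: add_Suc_right) (meson order_trans)
  qed simp
  hence "real (c + r + 1) * displacement (int (m (c + r))) (smoothing m g c r)
      \<le> real (c + r + 1) * displacement (int (m (c + r))) g"
    by (intro mult_left_mono) auto
  also have "\<dots> \<le> (1/2)^(c + r)" by (rule fast)
  finally have "real (c + r + 1) * displacement (int (m (c + r))) (smoothing m g c r) \<le> (1/2)^(c + r)" .
  moreover have "(\<integral>x. \<bar>smoothing m g c (Suc r) x - smoothing m g c r x\<bar> \<partial>M)
      \<le> real (c + r + 1) * displacement (int (m (c + r))) (smoothing m g c r)"
    unfolding smoothing.simps by (rule orbit_average_L1[OF bounded_observable_smoothing[OF g]]) simp
  ultimately show ?thesis by linarith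
qed

text \<open>
  The increments \<open>D c r\<close> have integrals at most \<open>(1/2) ^ (c + r)\<close>. Their double sum over \<open>c\<close> and
  \<open>r\<close> is therefore integrable, and finite almost everywhere. Where it is finite, each row converges, and
  the distance from \<open>g\<close> to the limit of row \<open>c\<close> is at most the sum over row \<open>c\<close>, the general term of a
  convergent series.
\<close>

lemma AE_smoothing_converges:
  assumes g: "bounded_observable g"
    and fast: "\<And>i. real (i + 1) * displacement (int (m i)) g \<le> (1/2)^i"
  shows "AE x in M. (\<forall>c. convergent (\<lambda>r. smoothing m g c r x)) \<and>
    (\<lambda>c. lim (\<lambda>r. smoothing m g c r x)) \<longlonglongrightarrow> g x"
proof -
  define D where "D c r x = \<bar>smoothing m g c (Suc r) x - smoothing m g c r x\<bar>" for c r x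
  have bm: "smoothing m g c r \<in> borel_measurable M" for c r
    using bounded_observable_smoothing[OF g] by (simp add: bounded_observable_def)
  note [measurable] = bm
  have [measurable]: "D c r \<in> borel_measurable M" for c r
    unfolding D_def[abs_def] by measurable
  have intD: "integrable M (D c r)" for c r
    using integrable_displacement[OF bounded_observable_smoothing[OF g] bounded_observable_smoothing[OF g],
        of m c "Suc r" 0 m c r 0] unfolding D_def[abs_def] by simp
  have nnD: "(\<integral>\<^sup>+x. ennreal (D c r x) \<partial>M) \<le> ennreal ((1/2)^c * (1/2)^r)" for c r
  proof -
    have "(\<integral>\<^sup>+x. ennreal (D c r x) \<partial>M) = ennreal (\<integral>x. D c r x \<partial>M)"
      by (rule nn_integral_eq_integral[OF intD]) (simp add: D_def)
    also have "\<dots> \<le> ennreal ((1/2)^(c + r))"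
      using smoothing_step_L1[OF g fast, of c r] unfolding D_def by (rule ennreal_leI)
    finally show ?thesis by (simp only: power_add)
  qed
  have geo: "(\<Sum>r. ennreal (a * (1/2)^r)) = ennreal (a * 2)" if "0 \<le> a" for a :: real
  proof -
    have "(\<lambda>r. a * (1/2::real)^r) sums (a * (1 / (1 - 1/2)))"
      by (intro sums_mult geometric_sums) simp
    thus ?thesis using that by (intro suminf_ennreal_eq) auto
  qed
  have "(\<integral>\<^sup>+x. (\<Sum>c. \<Sum>r. ennreal (D c r x)) \<partial>M) = (\<Sum>c. \<Sum>r. \<integral>\<^sup>+x. ennreal (D c r x) \<partial>M)"
    by (simp add: nn_integral_suminf)
  also have "\<dots> \<le> (\<Sum>c. \<Sum>r. ennreal ((1/2)^c * (1/2)^r))"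
    by (intro suminf_le nnD summableI allI)
  also have "\<dots> = (\<Sum>c. ennreal (2 * (1/2)^c))"
    by (subst geo) (auto simp: mult.commute)
  also have "\<dots> = ennreal (2 * 2)" by (rule geo) simp
  also have "\<dots> < \<infinity>" by simp
  finally have "AE x in M. (\<Sum>c. \<Sum>r. ennreal (D c r x)) \<noteq> \<infinity>"
    by (intro nn_integral_PInf_AE) auto
  thus ?thesis
  proof (rule AE_mp, intro AE_I2 impI)
    fix x assume fin: "(\<Sum>c. \<Sum>r. ennreal (D c r x)) \<noteq> \<infinity>"
    let ?s = "\<lambda>c r. smoothing m g c r x"
    have D0: "0 \<le> D c r x" for c r by (simp add: D_def)
    have row_fin: "(\<Sum>r. ennreal (D c r x)) \<noteq> \<infinity>" for c
    proof -
      have "(\<Sum>r. ennreal (D c r x)) \<le> (\<Sum>c. \<Sum>r. ennreal (D c r x))"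
        using sum_le_suminf[of "\<lambda>c. \<Sum>r. ennreal (D c r x)" "{c}"] by (simp add: summableI)
      thus ?thesis using fin by (auto simp: top_unique)
    qed
    have summD: "summable (\<lambda>r. D c r x)" for c
      using row_fin[of c] D0 by (intro summable_suminf_not_top) auto
    have eqD: "(\<Sum>r. ennreal (D c r x)) = ennreal (\<Sum>r. D c r x)" for c
      using summD[of c] D0 by (intro suminf_ennreal2) auto
    have summ: "summable (\<lambda>c. \<Sum>r. D c r x)"
    proof (rule summable_suminf_not_top)
      show "0 \<le> (\<Sum>r. D c r x)" for c by (rule suminf_nonneg[OF summD D0])
      show "(\<Sum>c. ennreal (\<Sum>r. D c r x)) \<noteq> top" using fin unfolding eqD by simp
    qed
    hence tail: "(\<lambda>c. \<Sum>r. D c r x) \<longlonglongrightarrow> 0" by (rule summable_LIMSEQ_zero)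
    have diffs: "summable (\<lambda>r. ?s c (Suc r) - ?s c r)" for c
      using summD[of c] unfolding D_def by (rule summable_rabs_cancel)
    have conv: "?s c \<longlonglongrightarrow> g x + (\<Sum>r. ?s c (Suc r) - ?s c r)" for c
    proof -
      have "(\<lambda>r. \<Sum>i<r. ?s c (Suc i) - ?s c i) \<longlonglongrightarrow> (\<Sum>r. ?s c (Suc r) - ?s c r)"
        using diffs by (rule summable_LIMSEQ)
      hence "(\<lambda>r. g x + (?s c r - ?s c 0)) \<longlonglongrightarrow> g x + (\<Sum>r. ?s c (Suc r) - ?s c r)"
        unfolding sum_lessThan_telescope[of "?s c"] by (intro tendsto_add tendsto_const)
      thus ?thesis by simp
    qed
    have "\<bar>lim (?s c) - g x\<bar> \<le> (\<Sum>r. D c r x)" for c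
      using summable_rabs[of "\<lambda>r. ?s c (Suc r) - ?s c r"] summD[of c] limI[OF conv[of c]]
      unfolding D_def by simp
    hence "(\<lambda>c. lim (?s c) - g x) \<longlonglongrightarrow> 0"
      by (intro Lim_null_comparison[OF _ tail]) simp
    hence "(\<lambda>c. lim (?s c)) \<longlonglongrightarrow> g x" by (simp add: LIM_zero_iff)
    thus "(\<forall>c. convergent (?s c)) \<and> (\<lambda>c. lim (?s c)) \<longlonglongrightarrow> g x"
      using conv by (auto simp: convergent_def)
  qed
qed

end

section \<open>Isomorphisms given by injective observables\<close>

lemma in_sets_restrict_space:
  "X \<in> sets M \<Longrightarrow> A \<in> sets (restrict_space M X) \<longleftrightarrow> A \<subseteq> X \<and> A \<in> sets M"
  by (rule sets_restrict_space_iff) (simp add: sets.Int_space_eq2)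

text \<open>
  A standard space has a real observable that is injective up to a null set and has measurable
  images. The isomorphism to a measure on the reals is measurable for the completions only; \<open>h\<close> is a
  version of it that is measurable for the original space, and \<open>X\<close> the set where both agree.
\<close>

lemma standard_space_coding:
  fixes M :: "'a measure"
  assumes "standard_space M"
  obtains h :: "'a \<Rightarrow> real" and X where
    "h \<in> borel_measurable M" "X \<in> sets (completion M)" "AE x in M. x \<in> X" "inj_on h X"
    "\<And>A. A \<in> sets (completion M) \<Longrightarrow> A \<subseteq> X \<Longrightarrow> h ` A \<in> sets (completion (distr M borel h))"
proof -
  obtain \<nu> :: "real measure" and X Y \<phi> where \<nu>: "sets \<nu> = sets borel"
    and iso: "iso_mod0 (completion M) (completion \<nu>) X Y \<phi>"
    using assms unfolding standard_space_def by blast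
  let ?M = "completion M" and ?N = "completion \<nu>"
  have X: "X \<in> sets ?M" "space ?M - X \<in> null_sets ?M"
    and Y: "Y \<in> sets ?N" "space ?N - Y \<in> null_sets ?N"
    and bij: "bij_betw \<phi> X Y"
    and \<phi>: "\<phi> \<in> measurable (restrict_space ?M X) (restrict_space ?N Y)"
    and inv: "the_inv_into X \<phi> \<in> measurable (restrict_space ?N Y) (restrict_space ?M X)"
    and dist: "distr (restrict_space ?M X) (restrict_space ?N Y) \<phi> = restrict_space ?N Y"
    using iso unfolding iso_mod0_def by blast+
  define \<phi>' where "\<phi>' x = (if x \<in> X then \<phi> x else 0)" for x
  have "\<phi> \<in> measurable (restrict_space ?M X) ?N"
    using \<phi> by (simp add: measurable_restrict_space2_iff)
  moreover have "(\<lambda>x. x) \<in> measurable ?N borel"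
    using \<nu> by (intro measurable_completion) (simp add: measurable_def sets_eq_imp_space_eq)
  ultimately have "\<phi> \<in> measurable (restrict_space ?M X) borel" by (rule measurable_compose)
  hence \<phi>'_meas: "\<phi>' \<in> borel_measurable ?M"
    unfolding \<phi>'_def[abs_def] using X(1) by (subst (asm) measurable_restrict_space_iff) auto
  obtain h where h: "h \<in> borel_measurable M" and eq: "AE x in M. \<phi>' x = h x"
    using completion_ex_borel_measurable_real[OF \<phi>'_meas] by blast
  have [measurable]: "h \<in> borel_measurable ?M" using h by (rule measurable_completion)
  note [measurable] = \<phi>'_meas X(1)
  have XAE: "AE x in ?M. x \<in> X" using X by (intro AE_I'[OF X(2)]) auto
  define X0 where "X0 = {x \<in> space ?M. x \<in> X \<and> \<phi>' x = h x}"
  have X0: "X0 \<in> sets ?M" unfolding X0_def by measurable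
  have X0X: "X0 \<subseteq> X" by (auto simp: X0_def)
  have h\<phi>: "h x = \<phi> x" if "x \<in> X0" for x using that by (auto simp: X0_def \<phi>'_def)
  have \<nu>_eq: "distr M borel h = \<nu>"
  proof (rule measure_eqI)
    show "sets (distr M borel h) = sets \<nu>" using \<nu> by simp
    fix B assume "B \<in> sets (distr M borel h)"
    hence B[measurable]: "B \<in> sets borel" by simp
    hence BN: "B \<in> sets ?N" using \<nu> by simp
    have BY: "B \<inter> Y \<in> sets (restrict_space ?N Y)"
      using BN by (auto simp: sets_restrict_space)
    have "emeasure (distr M borel h) B = emeasure ?M (h -` B \<inter> space M)"
      using h B by (simp add: emeasure_distr measurable_sets)
    also have "\<dots> = emeasure ?M (\<phi> -` (B \<inter> Y) \<inter> X)"
    proof (rule emeasure_eq_AE)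
      have img: "\<And>x. x \<in> X \<Longrightarrow> \<phi> x \<in> Y" using bij by (auto simp: bij_betw_def)
      show "AE x in ?M. (x \<in> h -` B \<inter> space M) = (x \<in> \<phi> -` (B \<inter> Y) \<inter> X)"
        using XAE AE_completion[OF eq] AE_space
        by eventually_elim (auto simp: \<phi>'_def dest: img)
      have "h -` B \<inter> space ?M \<in> sets ?M" by measurable
      thus "h -` B \<inter> space M \<in> sets ?M" by simp
      from measurable_sets[OF \<phi> BY] show "\<phi> -` (B \<inter> Y) \<inter> X \<in> sets ?M"
        using X(1) sets.sets_into_space[OF X(1)]
        by (auto simp: in_sets_restrict_space space_restrict_space Int_absorb1 Int_absorb2)
    qed
    also have "\<dots> = emeasure (restrict_space ?M X) (\<phi> -` (B \<inter> Y) \<inter> X)"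
      using X(1) by (intro emeasure_restrict_space[symmetric]) auto
    also have "\<dots> = emeasure (distr (restrict_space ?M X) (restrict_space ?N Y) \<phi>) (B \<inter> Y)"
      using sets.sets_into_space[OF X(1)]
      by (subst emeasure_distr[OF \<phi> BY]) (simp add: space_restrict_space Int_absorb1 Int_absorb2)
    also have "\<dots> = emeasure ?N (B \<inter> Y)"
      unfolding dist using Y(1) by (intro emeasure_restrict_space) auto
    also have "\<dots> = emeasure ?N B"
      using BN Y by (intro emeasure_eq_AE AE_I'[OF Y(2)]) (auto dest: sets.sets_into_space)
    also have "\<dots> = emeasure \<nu> B" using B \<nu> by simp
    finally show "emeasure (distr M borel h) B = emeasure \<nu> B" .
  qed
  show thesis
  proof (rule that[OF h X0])
    have "AE x in ?M. x \<in> X0"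
      using XAE AE_completion[OF eq] AE_space unfolding X0_def by eventually_elim auto
    thus "AE x in M. x \<in> X0" by (simp add: AE_completion_iff)
    show "inj_on h X0"
      using bij X0X h\<phi> unfolding bij_betw_def inj_on_def by (metis subsetD)
    fix A assume A: "A \<in> sets ?M" "A \<subseteq> X0"
    hence "A \<in> sets (restrict_space ?M X)"
      using X(1) X0X by (auto simp: in_sets_restrict_space)
    from measurable_sets[OF inv this]
    have "the_inv_into X \<phi> -` A \<inter> Y \<in> sets ?N"
      using Y(1) sets.sets_into_space[OF Y(1)]
      by (auto simp: in_sets_restrict_space space_restrict_space Int_absorb1 Int_absorb2)
    also have "the_inv_into X \<phi> -` A \<inter> Y = \<phi> ` A"
    proof -
      have "inj_on \<phi> X" "Y = \<phi> ` X" using bij by (auto simp: bij_betw_def)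
      thus ?thesis using A(2) X0X by (auto simp: the_inv_into_f_f subset_iff intro!: image_eqI)
    qed
    also have "\<phi> ` A = h ` A" using A(2) h\<phi> by (intro image_cong) auto
    finally show "h ` A \<in> sets (completion (distr M borel h))" unfolding \<nu>_eq .
  qed
qed

context mps
begin

text \<open>
  If the coding observable \<open>h\<close> can be recovered from \<open>\<Phi>\<close> by a Borel function \<open>G\<close>, then \<open>\<Phi>\<close> is
  injective up to a null set. The point is to see that images under \<open>\<Phi>\<close> are measurable. Conversely to
  \<open>G\<close>, each coordinate of \<open>\<Phi>\<close> is a Borel function \<open>F k\<close> of \<open>h\<close> almost everywhere, because \<open>h\<close> has
  measurable images. Hence \<open>\<Phi> ` A\<close> consists of those \<open>y\<close> with \<open>G y \<in> h ` A\<close> that satisfy the Borel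
  conditions \<open>F k (G y) = y k\<close>, and measurability of \<open>h ` A\<close> carries over.
\<close>

lemma isomorphic_mps_factor:
  fixes \<Phi> :: "'a \<Rightarrow> nat \<Rightarrow> real" and h :: "'a \<Rightarrow> real"
  assumes h [measurable]: "h \<in> borel_measurable M"
    and X0: "X0 \<in> sets (completion M)" "AE x in M. x \<in> X0" and inj: "inj_on h X0"
    and image: "\<And>A. A \<in> sets (completion M) \<Longrightarrow> A \<subseteq> X0 \<Longrightarrow>
      h ` A \<in> sets (completion (distr M borel h))"
    and \<Phi>: "\<Phi> \<in> measurable M (restrict_space borel W)"
    and G [measurable]: "G \<in> borel_measurable borel"
    and G\<Phi>: "AE x in M. G (\<Phi> x) = h x"
    and equivariant: "\<And>x. x \<in> space M \<Longrightarrow> \<Phi> (T x) = S (\<Phi> x)"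
  shows "isomorphic_mps M T (distr M (restrict_space borel W) \<Phi>) S"
proof -
  let ?N = "restrict_space borel W :: (nat \<Rightarrow> real) measure"
  define \<mu> where "\<mu> = distr M ?N \<Phi>"
  define \<nu> where "\<nu> = distr M borel h"
  let ?M = "completion M" and ?\<mu> = "completion \<mu>" and ?\<nu> = "completion \<nu>"
  note [measurable] = \<Phi>
  have sets_\<nu> [measurable_cong]: "sets \<nu> = sets borel" by (simp add: \<nu>_def)
  have \<Phi>k [measurable]: "(\<lambda>x. \<Phi> x k) \<in> borel_measurable M" for k
  proof -
    have "\<Phi> \<in> measurable M borel" using \<Phi> by (simp add: measurable_restrict_space2_iff)
    thus ?thesis by (rule measurable_compose[OF _ measurable_product_coordinates])
  qed
  have "\<exists>F. F \<in> borel_measurable borel \<and> (AE x in M. F (h x) = \<Phi> x k)" for k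
  proof -
    let ?H = "h ` X0"
    have H: "?H \<in> sets ?\<nu>" unfolding \<nu>_def using X0(1) by (intro image) auto
    define F where "F b = (if b \<in> ?H then \<Phi> (the_inv_into X0 h b) k else 0)" for b
    have "(\<lambda>b. \<Phi> (the_inv_into X0 h b) k) \<in> borel_measurable (restrict_space ?\<nu> ?H)"
    proof (rule measurableI)
      fix B :: "real set" assume B [measurable]: "B \<in> sets borel"
      let ?A = "X0 \<inter> ((\<lambda>x. \<Phi> x k) -` B \<inter> space M)"
      have "(\<lambda>x. \<Phi> x k) -` B \<inter> space M \<in> sets M" by measurable
      hence "h ` ?A \<in> sets ?\<nu>" unfolding \<nu>_def using X0(1) by (intro image) auto
      also have "h ` ?A = (\<lambda>b. \<Phi> (the_inv_into X0 h b) k) -` B \<inter> ?H"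
        using sets.sets_into_space[OF X0(1)] inj
        by (auto simp: the_inv_into_f_f intro!: image_eqI)
      finally show "(\<lambda>b. \<Phi> (the_inv_into X0 h b) k) -` B \<inter> space (restrict_space ?\<nu> ?H)
          \<in> sets (restrict_space ?\<nu> ?H)"
        using H sets.sets_into_space[OF H]
        by (auto simp: in_sets_restrict_space space_restrict_space Int_absorb1 Int_absorb2)
    qed simp
    hence "F \<in> borel_measurable ?\<nu>"
      unfolding F_def[abs_def] using H by (subst (asm) measurable_restrict_space_iff) auto
    then obtain F' where F': "F' \<in> borel_measurable \<nu>" "AE b in \<nu>. F b = F' b"
      using completion_ex_borel_measurable_real by blast
    have "AE x in M. F (h x) = F' (h x)"
      using F'(2) unfolding \<nu>_def by (rule AE_distrD[OF h])
    hence "AE x in M. F' (h x) = \<Phi> x k"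
      using X0(2) by eventually_elim (simp add: F_def the_inv_into_f_f[OF inj])
    moreover have "F' \<in> borel_measurable borel"
      using F'(1) sets_\<nu> by (simp cong: measurable_cong_sets)
    ultimately show ?thesis by blast
  qed
  then obtain F where F [measurable]: "\<And>k. F k \<in> borel_measurable borel"
    and F\<Phi>: "\<And>k. AE x in M. F k (h x) = \<Phi> x k" by metis
  have "AE x in M. \<forall>k. F k (h x) = \<Phi> x k" using F\<Phi> by (simp add: AE_all_countable)
  with X0(2) G\<Phi> have "AE x in M. x \<in> X0 \<and> G (\<Phi> x) = h x \<and> (\<forall>k. F k (h x) = \<Phi> x k)"
    by eventually_elim auto
  \<comment> \<open>All the almost sure identities hold on this invariant set, on which the isomorphism is defined.\<close>
  then obtain X where X: "X \<in> sets M" "AE x in M. x \<in> X"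
    and good: "\<And>x. x \<in> X \<Longrightarrow> x \<in> X0 \<and> G (\<Phi> x) = h x \<and> (\<forall>k. F k (h x) = \<Phi> x k)"
    and inv: "\<And>x k. x \<in> X \<Longrightarrow> iter k x \<in> X"
    by (rule invariant_core) (rule that)
  have XM: "X \<subseteq> space M" using X(1) by (rule sets.sets_into_space)
  have XX0: "X \<subseteq> X0" using good by blast
  have \<Phi>W: "\<Phi> x \<in> W" if "x \<in> space M" for x
    using measurable_space[OF \<Phi> that] by (simp add: space_restrict_space)
  have sets_\<mu>: "sets \<mu> = sets ?N" and space_\<mu>: "space \<mu> = W"
    by (simp_all add: \<mu>_def space_restrict_space)
  have \<Phi>\<mu>: "\<Phi> \<in> measurable M \<mu>" using \<Phi> by (simp add: \<mu>_def)
  have distr_\<Phi>: "distr ?M \<mu> \<Phi> = \<mu>"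
    unfolding distr_completion[OF \<Phi>\<mu>] by (simp add: \<mu>_def cong: distr_cong)
  have \<Phi>_compl: "\<Phi> \<in> measurable ?M ?\<mu>"
    by (rule completion.measurable_completion2[OF measurable_completion[OF \<Phi>\<mu>]])
       (simp add: distr_\<Phi>)
  have \<mu>_compl: "?\<mu> = distr ?M ?\<mu> \<Phi>"
    using completion.completion_distr_eq[OF measurable_completion[OF \<Phi>\<mu>]] by (simp add: distr_\<Phi>)
  have G\<mu>: "G \<in> measurable \<mu> \<nu>"
  proof -
    have "G \<in> measurable ?N borel" by (rule measurable_restrict_space1) (rule G)
    thus ?thesis using sets_\<mu> sets_\<nu> by (simp cong: measurable_cong_sets)
  qed
  have "distr ?\<mu> \<nu> G = distr M \<nu> (\<lambda>x. G (\<Phi> x))"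
    unfolding distr_completion[OF G\<mu>] using G\<mu> \<Phi>\<mu>
    by (subst \<mu>_def, subst distr_distr) (auto simp: \<mu>_def o_def)
  also have "\<dots> = distr M borel h"
  proof (rule distr_cong_AE)
    show "(\<lambda>x. G (\<Phi> x)) \<in> measurable M \<nu>" using \<Phi>\<mu> G\<mu> by (rule measurable_compose)
  qed (use G\<Phi> sets_\<nu> h in auto)
  finally have "distr ?\<mu> \<nu> G = \<nu>" by (simp add: \<nu>_def)
  hence G_compl: "G \<in> measurable ?\<mu> ?\<nu>"
    by (intro completion.measurable_completion2 measurable_completion G\<mu>) simp
  define E where "E = {y \<in> space ?N. \<forall>k. F k (G y) = y k}"
  have "E \<in> sets ?N"
  proof -
    have "G \<in> borel_measurable ?N" "(\<lambda>y. y k) \<in> borel_measurable ?N" for k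
      by (rule measurable_restrict_space1, measurable)+
    hence "{y \<in> space ?N. F k (G y) = y k} \<in> sets ?N" for k
      by (intro borel_measurable_eq measurable_compose[OF _ F])
    thus ?thesis unfolding E_def by (rule sets.sets_Collect_countable_All)
  qed
  hence E: "E \<in> sets ?\<mu>" using sets_\<mu> by simp
  have image\<Phi>: "\<Phi> ` A \<in> sets ?\<mu>" if A: "A \<in> sets ?M" "A \<subseteq> X" for A
  proof -
    have "h ` A \<in> sets ?\<nu>" unfolding \<nu>_def using A XX0 by (intro image) auto
    hence "G -` (h ` A) \<inter> space ?\<mu> \<in> sets ?\<mu>" by (rule measurable_sets[OF G_compl])
    with E have "E \<inter> (G -` (h ` A) \<inter> space ?\<mu>) \<in> sets ?\<mu>" by (rule sets.Int)
    also have "E \<inter> (G -` (h ` A) \<inter> space ?\<mu>) = \<Phi> ` A"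
    proof (intro subset_antisym subsetI)
      fix y assume "y \<in> E \<inter> (G -` (h ` A) \<inter> space ?\<mu>)"
      then obtain x where "x \<in> A" "G y = h x" "\<forall>k. F k (G y) = y k"
        unfolding E_def by auto
      moreover have "\<forall>k. F k (h x) = \<Phi> x k" using \<open>x \<in> A\<close> A(2) good by blast
      ultimately have "y = \<Phi> x" by (intro ext) metis
      thus "y \<in> \<Phi> ` A" using \<open>x \<in> A\<close> by blast
    next
      fix y assume "y \<in> \<Phi> ` A"
      then obtain x where x: "x \<in> A" "y = \<Phi> x" by blast
      hence "x \<in> X" using A(2) by blast
      with x good[of x] XM \<Phi>W[of x] show "y \<in> E \<inter> (G -` (h ` A) \<inter> space ?\<mu>)"
        by (auto simp: E_def space_\<mu> space_restrict_space)
    qed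
    finally show ?thesis .
  qed
  define Y where "Y = \<Phi> ` X"
  have Xc: "X \<in> sets ?M" using X(1) by simp
  have Y: "Y \<in> sets ?\<mu>" unfolding Y_def using Xc by (intro image\<Phi>) auto
  have XAE: "AE x in ?M. x \<in> X" using X(2) by (rule AE_completion)
  have "{y \<in> space ?\<mu>. y \<in> Y} = Y" using sets.sets_into_space[OF Y] by auto
  hence "{y \<in> space ?\<mu>. y \<in> Y} \<in> sets ?\<mu>" using Y by (simp only:)
  moreover have "AE x in ?M. \<Phi> x \<in> Y" using XAE by eventually_elim (simp add: Y_def)
  ultimately have "AE y in distr ?M ?\<mu> \<Phi>. y \<in> Y" by (simp only: AE_distr_iff[OF \<Phi>_compl])
  hence YAE: "AE y in ?\<mu>. y \<in> Y" unfolding \<mu>_compl[symmetric] .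
  have null: "space L - A \<in> null_sets L" if "A \<in> sets L" "AE x in L. x \<in> A" for L :: "'c measure" and A
  proof -
    have "{x \<in> space L. x \<notin> A} = space L - A" by auto
    thus ?thesis using that by (subst (asm) AE_iff_null) auto
  qed
  have inj\<Phi>: "inj_on \<Phi> X"
  proof (rule inj_onI)
    fix x y assume "x \<in> X" "y \<in> X" "\<Phi> x = \<Phi> y"
    hence "h x = h y" using good by metis
    thus "x = y" using \<open>x \<in> X\<close> \<open>y \<in> X\<close> inj XX0 by (auto dest: inj_onD)
  qed
  have spX: "space (restrict_space ?M X) = X" using XM by (auto simp: space_restrict_space)
  have spY: "space (restrict_space ?\<mu> Y) = Y"
    using sets.sets_into_space[OF Y] by (auto simp: space_restrict_space)
  have \<Phi>XY: "\<Phi> \<in> measurable (restrict_space ?M X) (restrict_space ?\<mu> Y)"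
    by (rule measurable_restrict_space3[OF \<Phi>_compl]) (auto simp: Y_def)
  have iso: "iso_mod0 ?M ?\<mu> X Y \<Phi>"
    unfolding iso_mod0_def
  proof (intro conjI)
    show "X \<in> sets ?M" "Y \<in> sets ?\<mu>" by (fact Xc, fact Y)
    show "space ?M - X \<in> null_sets ?M" "space ?\<mu> - Y \<in> null_sets ?\<mu>"
      by (rule null[OF Xc XAE], rule null[OF Y YAE])
    show "bij_betw \<Phi> X Y" using inj\<Phi> by (simp add: Y_def bij_betw_def)
    show "\<Phi> \<in> measurable (restrict_space ?M X) (restrict_space ?\<mu> Y)" by (fact \<Phi>XY)
    show "the_inv_into X \<Phi> \<in> measurable (restrict_space ?\<mu> Y) (restrict_space ?M X)"
    proof (rule measurableI)
      show "the_inv_into X \<Phi> y \<in> space (restrict_space ?M X)" if "y \<in> space (restrict_space ?\<mu> Y)" for y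
        using that inj\<Phi> unfolding spX spY by (auto simp: Y_def the_inv_into_f_f)
      fix A assume "A \<in> sets (restrict_space ?M X)"
      hence A: "A \<in> sets ?M" "A \<subseteq> X" using Xc by (auto simp: in_sets_restrict_space)
      have "the_inv_into X \<Phi> -` A \<inter> Y = \<Phi> ` A"
        using A(2) inj\<Phi> by (auto simp: Y_def the_inv_into_f_f subset_iff intro!: image_eqI)
      thus "the_inv_into X \<Phi> -` A \<inter> space (restrict_space ?\<mu> Y) \<in> sets (restrict_space ?\<mu> Y)"
        using image\<Phi>[OF A] Y A(2) unfolding spY by (auto simp: in_sets_restrict_space Y_def)
    qed
    show "distr (restrict_space ?M X) (restrict_space ?\<mu> Y) \<Phi> = restrict_space ?\<mu> Y"
    proof (rule measure_eqI)
      fix A assume "A \<in> sets (distr (restrict_space ?M X) (restrict_space ?\<mu> Y) \<Phi>)"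
      hence A: "A \<in> sets (restrict_space ?\<mu> Y)" by simp
      hence A': "A \<in> sets ?\<mu>" "A \<subseteq> Y" using Y by (auto simp: in_sets_restrict_space)
      have "emeasure (distr (restrict_space ?M X) (restrict_space ?\<mu> Y) \<Phi>) A
          = emeasure (restrict_space ?M X) (\<Phi> -` A \<inter> X)"
        using emeasure_distr[OF \<Phi>XY A] unfolding spX .
      also have "\<dots> = emeasure ?M (\<Phi> -` A \<inter> X)"
        using Xc by (intro emeasure_restrict_space) auto
      also have "\<dots> = emeasure ?M (\<Phi> -` A \<inter> space ?M)"
      proof (rule emeasure_eq_AE)
        show "AE x in ?M. (x \<in> \<Phi> -` A \<inter> X) = (x \<in> \<Phi> -` A \<inter> space ?M)"
          using XAE AE_space by eventually_elim auto
        show *: "\<Phi> -` A \<inter> space ?M \<in> sets ?M" using \<Phi>_compl A'(1) by (rule measurable_sets)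
        have "\<Phi> -` A \<inter> X = (\<Phi> -` A \<inter> space ?M) \<inter> X" using XM by auto
        thus "\<Phi> -` A \<inter> X \<in> sets ?M" using * Xc by (simp only: sets.Int)
      qed
      also have "\<dots> = emeasure (distr ?M ?\<mu> \<Phi>) A"
        using \<Phi>_compl A'(1) by (rule emeasure_distr[symmetric])
      also have "\<dots> = emeasure ?\<mu> A" unfolding \<mu>_compl[symmetric] ..
      also have "\<dots> = emeasure (restrict_space ?\<mu> Y) A"
        using Y A'(2) by (intro emeasure_restrict_space[symmetric]) auto
      finally show "emeasure (distr (restrict_space ?M X) (restrict_space ?\<mu> Y) \<Phi>) A
          = emeasure (restrict_space ?\<mu> Y) A" .
    qed simp
  qed
  have TX: "T ` X = X"
  proof (intro subset_antisym subsetI)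
    fix y assume "y \<in> T ` X" thus "y \<in> X" using inv[of _ 1] by (auto simp: iter_1)
  next
    fix y assume y: "y \<in> X"
    hence "T (iter (-1) y) = y" using XM iter_add[of y 1 "-1"] by (auto simp: iter_1)
    thus "y \<in> T ` X" using inv[OF y, of "-1"] by (metis imageI)
  qed
  have "S ` Y = Y"
  proof -
    have "S ` Y = (\<lambda>x. S (\<Phi> x)) ` X" by (simp add: Y_def image_image)
    also have "\<dots> = \<Phi> ` T ` X" unfolding image_image using XM equivariant by (intro image_cong) auto
    finally show ?thesis by (simp add: TX Y_def)
  qed
  thus ?thesis
    unfolding isomorphic_mps_def \<mu>_def[symmetric] using iso TX XM equivariant by blast
qed

end

section \<open>Rigid systems inside the space of arrays\<close>

context mps
begin

text \<open>
  Rigidity speaks of \<open>L\<^sup>2\<close>; the \<open>L\<^sup>1\<close> norm is smaller on a probability space, by nonnegativity of the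
  variance.
\<close>

lemma rigid_displacement:
  assumes rigid: "rigid M T n" and g: "bounded_observable g"
  shows "(\<lambda>i. displacement (int (n i)) g) \<longlonglongrightarrow> 0"
proof -
  have [measurable]: "g \<in> borel_measurable M" using g by (simp add: bounded_observable_def)
  have bound: "\<bar>g x\<bar> \<le> 2" for x using g by (simp add: bounded_observable_def)
  let ?u = "\<lambda>i x. \<bar>g (iter (int (n i)) x) - g x\<bar>"
  have u4: "\<bar>?u i x\<bar> \<le> 4" for i x using bound[of x] bound[of "iter (int (n i)) x"] by linarith
  have "square_integrable M (\<lambda>x. complex_of_real (g x))"
    unfolding square_integrable_def
  proof (intro conjI integrable_const_bound[where B = 4])
    have "\<bar>g x\<bar>\<^sup>2 \<le> 2\<^sup>2" for x using bound by (intro power_mono) auto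
    thus "AE x in M. norm ((cmod (complex_of_real (g x)))\<^sup>2) \<le> 4" by simp
  qed measurable
  with rigid have lim: "(\<lambda>i. norm_L2 M (\<lambda>x. complex_of_real (g x) - complex_of_real (g ((T ^^ n i) x)))) \<longlonglongrightarrow> 0"
    unfolding rigid_def by blast
  have le: "displacement (int (n i)) g
      \<le> norm_L2 M (\<lambda>x. complex_of_real (g x) - complex_of_real (g ((T ^^ n i) x)))" for i
  proof -
    have int1: "integrable M (?u i)"
      using u4 by (intro integrable_const_bound[where B = 4]) auto
    have int2: "integrable M (\<lambda>x. (?u i x)\<^sup>2)"
    proof (rule integrable_const_bound[where B = "4\<^sup>2"])
      have "\<bar>?u i x\<bar>\<^sup>2 \<le> 4\<^sup>2" for x using u4 by (intro power_mono) auto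
      thus "AE x in M. norm ((?u i x)\<^sup>2) \<le> 4\<^sup>2" by simp
    qed measurable
    have "0 \<le> variance (?u i)" by (rule variance_positive)
    hence "(displacement (int (n i)) g)\<^sup>2 \<le> (\<integral>x. (?u i x)\<^sup>2 \<partial>M)"
      unfolding displacement_def using variance_eq[OF int1 int2] by simp
    hence "displacement (int (n i)) g \<le> sqrt (\<integral>x. (?u i x)\<^sup>2 \<partial>M)"
      by (rule real_le_rsqrt)
    also have "(\<integral>x. (?u i x)\<^sup>2 \<partial>M)
        = (\<integral>x. (cmod (complex_of_real (g x) - complex_of_real (g ((T ^^ n i) x))))\<^sup>2 \<partial>M)"
      by (intro Bochner_Integration.integral_cong refl)
         (simp add: iter_nat of_real_diff[symmetric] power2_commute del: of_real_diff)
    finally show ?thesis unfolding norm_L2_def .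
  qed
  show ?thesis
    by (rule Lim_null_comparison[OF _ lim]) (simp add: displacement_nonneg le)
qed

end

text \<open>
  The factor \<open>i + 1\<close> is the number of translates in the average taken at step \<open>i\<close>.
\<close>

lemma fast_growing_subsequence:
  fixes n :: "nat \<Rightarrow> nat" and d :: "nat \<Rightarrow> real"
  assumes n: "strict_mono n" and d: "d \<longlonglongrightarrow> 0"
  obtains k where "strict_mono k" "fast_growing (n \<circ> k)"
    "\<And>i. real (i + 1) * d (k i) \<le> (1/2)^i"
proof -
  have tail: "\<exists>J. \<forall>j\<ge>J. real (i + 1) * d j \<le> (1/2)^i" for i
  proof -
    have "0 < (1/2)^i / real (i + 1)" by simp
    from LIMSEQ_D[OF d this] obtain J where J: "\<And>j. j \<ge> J \<Longrightarrow> \<bar>d j\<bar> < (1/2)^i / real (i + 1)"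
      by auto
    have "real (i + 1) * d j \<le> (1/2)^i" if "j \<ge> J" for j
    proof -
      have "d j \<le> (1/2)^i / real (i + 1)" using J[OF that] by linarith
      thus ?thesis by (simp add: le_divide_eq mult.commute)
    qed
    thus ?thesis by blast
  qed
  have big: "j \<le> n j" for j using n by (rule strict_mono_imp_increasing)
  let ?P = "\<lambda>i j. 0 < n j \<and> real (i + 1) * d j \<le> (1/2)^i"
  have "\<exists>k. \<forall>i. ?P i (k i) \<and> k i < k (Suc i) \<and> (i + 2)\<^sup>2 * n (k i) \<le> n (k (Suc i))"
  proof -
    obtain J where J: "\<forall>j\<ge>J. real (0 + 1) * d j \<le> (1/2)^0" using tail by blast
    have "?P 0 (Suc J)" using J big[of "Suc J"] by auto
    moreover have "\<exists>j'. ?P (Suc i) j' \<and> j < j' \<and> (i + 2)\<^sup>2 * n j \<le> n j'" for i j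
    proof -
      obtain J where J: "\<forall>j\<ge>J. real (Suc i + 1) * d j \<le> (1/2)^Suc i" using tail by blast
      define j' where "j' = Suc (max J (max j ((i + 2)\<^sup>2 * n j)))"
      have "(i + 2)\<^sup>2 * n j < j'" "J \<le> j'" "j < j'" unfolding j'_def by (auto simp: less_Suc_eq_le)
      thus ?thesis using J big[of j'] by (intro exI[of _ j']) auto
    qed
    ultimately show ?thesis
      using dependent_nat_choice[of ?P "\<lambda>i j j'. j < j' \<and> (i + 2)\<^sup>2 * n j \<le> n j'"] by blast
  qed
  then obtain k where k: "\<And>i. ?P i (k i)" "\<And>i. k i < k (Suc i)"
    "\<And>i. (i + 2)\<^sup>2 * n (k i) \<le> n (k (Suc i))" by blast
  show thesis
    using k by (intro that[of k]) (auto simp: strict_mono_Suc_iff fast_growing_def)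
qed

text \<open>
  It remains to combine the parts: the subsequence is chosen for the observable \<open>arctan \<circ> h\<close>, where
  \<open>h\<close> codes the points of the space, and \<open>\<Phi>\<close> records its smoothings along the orbits.
\<close>

theorem theorem1p1:
  fixes M :: "'a measure" and T :: "'a \<Rightarrow> 'a" and n :: "nat \<Rightarrow> nat"
  assumes "standard_space M"
    and "invertible_mps M T"
    and "ergodic M T"
    and "non_periodic M"
    and "rigid M T n"
  shows "\<exists>(Y :: (nat \<Rightarrow> real) set) S \<mu> k.
           topological_model M T Y S \<mu> \<and>
           strict_mono k \<and> uniformly_rigid Y S (n \<circ> k) \<and>
           weakly_mixing Y S"
proof -
  interpret prob_space M using assms(2) by (simp add: invertible_mps_def)
  interpret mps M T by unfold_locales (fact assms(2))
  obtain h :: "'a \<Rightarrow> real" and X where h [measurable]: "h \<in> borel_measurable M"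
    and X: "X \<in> sets (completion M)" "AE x in M. x \<in> X" and inj: "inj_on h X"
    and image: "\<And>A. A \<in> sets (completion M) \<Longrightarrow> A \<subseteq> X \<Longrightarrow>
      h ` A \<in> sets (completion (distr M borel h))"
    using standard_space_coding[OF assms(1)] by blast
  define g where "g x = arctan (h x)" for x
  have g: "bounded_observable g"
    unfolding bounded_observable_def
  proof (intro conjI allI)
    show "g \<in> borel_measurable M" unfolding g_def[abs_def] by measurable
    show "\<bar>g x\<bar> \<le> 2" for x
      using arctan_bounded[of "h x"] pi_less_4 by (simp add: g_def abs_le_iff)
  qed
  have tan_g: "tan (g x) = h x" for x by (simp add: g_def tan_arctan)
  have "strict_mono n" using assms(5) by (simp add: rigid_def)
  then obtain k where k: "strict_mono k" and m: "fast_growing (n \<circ> k)"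
    and close: "\<And>i. real (i + 1) * displacement (int (n (k i))) g \<le> (1/2)^i"
    using fast_growing_subsequence[OF _ rigid_displacement[OF assms(5) g]] by blast
  define W where "W = near_periodic (n \<circ> k)"
  let ?s = "\<lambda>c r x. smoothing (n \<circ> k) g c r x"
  have sm [measurable]: "smoothing (n \<circ> k) g c r \<in> borel_measurable M" for c r
    using bounded_observable_smoothing[OF g] by (simp add: bounded_observable_def)
  have "AE x in M. (\<forall>c. convergent (\<lambda>r. ?s c r x)) \<and> (\<lambda>c. lim (\<lambda>r. ?s c r x)) \<longlonglongrightarrow> g x"
    using AE_smoothing_converges[OF g, of "n \<circ> k"] close by simp
  then obtain Z where Z [measurable]: "Z \<in> sets M" "AE x in M. x \<in> Z"
    and good: "\<And>x. x \<in> Z \<Longrightarrow> (\<forall>c. convergent (\<lambda>r. ?s c r x)) \<and> (\<lambda>c. lim (\<lambda>r. ?s c r x)) \<longlonglongrightarrow> g x"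
    and inv: "\<And>x p. x \<in> Z \<Longrightarrow> iter p x \<in> Z"
    by (rule invariant_core) (rule that)
  have ZM: "Z \<subseteq> space M" using Z(1) by (rule sets.sets_into_space)
  define f where "f c x = lim (\<lambda>r. ?s c r x)" for c x
  have f_lim: "(\<lambda>r. ?s c r x) \<longlonglongrightarrow> f c x" if "x \<in> Z" for c x
    using good[OF that] unfolding f_def by (simp add: convergent_LIMSEQ_iff)
  have [measurable]: "f c \<in> borel_measurable M" for c unfolding f_def[abs_def] by measurable
  have f_bound: "\<bar>f c x\<bar> \<le> 2" if "x \<in> Z" for c x
    using bounded_observable_smoothing[OF g] unfolding bounded_observable_def
    by (intro LIMSEQ_le_const2[OF tendsto_rabs[OF f_lim[OF that]]]) blast
  have f_near: "\<bar>f c (iter (int (n (k i))) x) - f c x\<bar> \<le> 4 / real (i + 1)"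
    if x: "x \<in> Z" and i: "c \<le> i" for c x i
  proof (rule LIMSEQ_le_const2)
    show "(\<lambda>r. \<bar>?s c r (iter (int (n (k i))) x) - ?s c r x\<bar>) \<longlonglongrightarrow> \<bar>f c (iter (int (n (k i))) x) - f c x\<bar>"
      by (intro tendsto_intros f_lim inv x)
    show "\<exists>N. \<forall>r\<ge>N. \<bar>?s c r (iter (int (n (k i))) x) - ?s c r x\<bar> \<le> 4 / real (i + 1)"
      using smoothing_near_period[OF g i, of _ x "n \<circ> k"] x ZM
      by (intro exI[of _ "Suc i"]) auto
  qed
  \<comment> \<open>Off the invariant set \<open>Z\<close> the value 0 keeps the map equivariant and its values admissible.\<close>
  define \<Phi> where "\<Phi> x = (\<lambda>q. if x \<in> Z then f (row_of q) (iter (time_of q) x) else 0)" for x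
  have \<Phi>W: "\<Phi> x \<in> W" for x
  proof (cases "x \<in> Z")
    case True
    have "shift_array (int (n (k i))) (\<Phi> x) q = f (row_of q) (iter (int (n (k i))) (iter (time_of q) x))" for i q
      using True ZM iter_add[of x "int (n (k i))" "time_of q"]
      by (simp add: shift_array_def \<Phi>_def add.commute subset_iff)
    thus ?thesis
      unfolding W_def near_periodic_def
      using True f_bound[OF inv[OF True]] f_near[OF inv[OF True]] by (simp add: \<Phi>_def)
  next
    case False
    thus ?thesis by (simp add: W_def near_periodic_def \<Phi>_def shift_array_def)
  qed
  have "\<Phi> \<in> borel_measurable M"
    by (rule measurable_coordinatewise_then_product) (simp add: \<Phi>_def)
  hence \<Phi>: "\<Phi> \<in> measurable M (restrict_space borel W)"
    using \<Phi>W by (simp add: measurable_restrict_space2_iff)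
  have equivariant: "\<Phi> (T x) = shift_array 1 (\<Phi> x)" if x: "x \<in> space M" for x
  proof -
    have "T x \<in> Z \<longleftrightarrow> x \<in> Z"
    proof
      assume "T x \<in> Z"
      hence "iter (-1) (T x) \<in> Z" by (rule inv)
      thus "x \<in> Z" using x by (simp add: iter_T)
    qed (use inv[of x 1] in \<open>simp add: iter_1\<close>)
    thus ?thesis using x by (auto simp: \<Phi>_def shift_array_def iter_T)
  qed
  \<comment> \<open>The entries at time 0 tend to \<open>g x = arctan (h x)\<close>.\<close>
  define G where "G y = tan (lim (\<lambda>c. y (cell_at c 0)))" for y :: "nat \<Rightarrow> real"
  have "G \<in> borel_measurable borel" unfolding G_def[abs_def] tan_def by measurable
  moreover have "AE x in M. G (\<Phi> x) = h x"
    using Z(2)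
  proof eventually_elim
    case (elim x)
    have "(\<lambda>c. \<Phi> x (cell_at c 0)) \<longlonglongrightarrow> g x" using good[OF elim] elim by (simp add: \<Phi>_def f_def)
    thus ?case by (simp add: G_def limI tan_g)
  qed
  ultimately have "isomorphic_mps M T (distr M (restrict_space borel W) \<Phi>) (shift_array 1)"
    using isomorphic_mps_factor[OF h X inj image \<Phi> _ _ equivariant] by blast
  define \<mu> where "\<mu> = distr M (restrict_space borel W) \<Phi>"
  have "topological_model M T W (shift_array 1) \<mu>"
    unfolding topological_model_def
  proof (intro conjI)
    show "tds W (shift_array 1)" unfolding W_def by (rule tds_near_periodic)
    show "prob_space \<mu>" unfolding \<mu>_def using \<Phi> by (rule prob_space_distr)
    show "space \<mu> = W" by (simp add: \<mu>_def space_restrict_space)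
    show "sets \<mu> = sets (restrict_space borel W)" by (simp add: \<mu>_def)
    show "isomorphic_mps M T \<mu> (shift_array 1)" unfolding \<mu>_def by fact
    have "shift_array 1 \<in> borel_measurable borel"
      by (rule borel_measurable_continuous_onI[OF continuous_on_shift])
    hence S: "shift_array 1 \<in> measurable (restrict_space borel W) (restrict_space borel W)"
      by (rule measurable_restrict_space3) (simp add: W_def near_periodic_shift)
    have T: "T \<in> measurable M M" and MT: "distr M M T = M"
      using invertible by (auto simp: invertible_mps_def)
    have "distr \<mu> \<mu> (shift_array 1) = distr \<mu> (restrict_space borel W) (shift_array 1)"
      by (rule distr_cong) (simp_all add: \<mu>_def)
    also have "\<dots> = distr M (restrict_space borel W) (shift_array 1 \<circ> \<Phi>)"
      unfolding \<mu>_def by (rule distr_distr[OF S \<Phi>])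
    also have "\<dots> = distr M (restrict_space borel W) (\<Phi> \<circ> T)"
      by (rule distr_cong) (simp_all add: equivariant)
    also have "\<dots> = distr (distr M M T) (restrict_space borel W) \<Phi>"
      by (rule distr_distr[OF \<Phi> T, symmetric])
    finally show "distr \<mu> \<mu> (shift_array 1) = \<mu>" unfolding MT \<mu>_def .
  qed
  moreover have "uniformly_rigid W (shift_array 1) (n \<circ> k)"
    unfolding W_def using fast_growing_strict_mono[OF m] by (rule uniformly_rigid_near_periodic)
  moreover have "weakly_mixing W (shift_array 1)"
    unfolding W_def using m by (rule weakly_mixing_near_periodic)
  ultimately show ?thesis using k by blast
qed

end
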